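(* For any positive integer $v=12u+1$ with $u\equiv 0,1\pmod 4$ and $u\geq 4$, $J_{3}[v]=I_{3}[v]$.
   Context: An $S(2,4,v)$ design is a pair $(\mathcal{V},\mathcal{B})$ with $|\mathcal{V}|=v$ and $\mathcal{B}$ a family of 4-subsets (blocks) of $\mathcal{V}$ such that each 2-subset of $\mathcal{V}$ lies in exactly one block; it has $b_v=\frac{v(v-1)}{12}$ blocks. For integers $a\le b$, $[a,b]=\{a,\dots,b\}$, and $I_{3}[v]=[0,b_{v}]\setminus[b_{v}-7,b_{v}-1]$. $J_{3}[v]$ is the set of integers $k$ for which there exist three $S(2,4,v)$ designs on a common point set with block sets $\mathcal{B}_1,\mathcal{B}_2,\mathcal{B}_3$ such that $\mathcal{B}_1\cap\mathcal{B}_2=\mathcal{B}_1\cap\mathcal{B}_3=\mathcal{B}_2\cap\mathcal{B}_3$ and this common set has exactly $k$ blocks. *)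

theory Defs
  imports Main "HOL-Number_Theory.Cong"
begin

definition S24_design :: "nat \<Rightarrow> 'a set \<Rightarrow> 'a set set \<Rightarrow> bool" where
  "S24_design v V B \<longleftrightarrow>
     finite V \<and> card V = v \<and>
     (\<forall>b\<in>B. b \<subseteq> V \<and> card b = 4) \<and>
     (\<forall>P. P \<subseteq> V \<and> card P = 2 \<longrightarrow> (\<exists>!b. b \<in> B \<and> P \<subseteq> b))"

text \<open>The division is exact whenever an $S(2,4,v)$ design exists, in particular for
  $v \equiv 1$ modulo 12.\<close>

definition num_blocks :: "nat \<Rightarrow> int" where
  "num_blocks v = int v * (int v - 1) div 12"

definition I3 :: "nat \<Rightarrow> int set" where
  "I3 v = {0..num_blocks v} - {num_blocks v - 7..num_blocks v - 1}"

text \<open>The three designs need not be distinct. Drawing the points from the natural numbers is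
  no restriction, since every finite point set is in bijection with a set of naturals.\<close>

definition J3 :: "nat \<Rightarrow> int set" where
  "J3 v = {k. \<exists>(V :: nat set) B1 B2 B3.
     S24_design v V B1 \<and> S24_design v V B2 \<and> S24_design v V B3 \<and>
     B1 \<inter> B2 = B1 \<inter> B3 \<and> B1 \<inter> B3 = B2 \<inter> B3 \<and>
     int (card (B1 \<inter> B2)) = k}"

end

(* Both inclusions are statements about decompositions of a graph into 4-cliques.

   For J3 <= I3, delete the common blocks: three disjoint decompositions of one graph remain. Every
   point then lies on r >= 2 blocks, and a block through a point with r = 2 meets some block of each
   other decomposition in three points. This leaves at most two points with r = 2 on a block, and
   such a pair occurs at most once at each of these points. Counting incidences and using that a
   point with r >= 3 has at least nine neighbours, the number of blocks is 0 or at least 8.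

   For I3 <= J3, blow up each point of a 4-GDD of type 3^u to four points, replace its blocks by
   triples of transversal designs TD(4,4) sharing 0, 1, 2 or 16 blocks, and fill the groups together
   with a new point by triples of projective planes of order 3 sharing 0, ..., 5 or 13 blocks. The
   4-GDDs exist for all u = 0, 1 (mod 4) by induction: write u = 4t + h with h <= t and truncate one
   group of a TD(5,t) to size h. *)

theory Submission
  imports Defs "HOL-Library.Disjoint_Sets" "HOL-Library.Code_Binary_Nat"
begin

section \<open>Decompositions of graphs into cliques\<close>

text \<open>Working with edge sets puts both inclusions on one footing: deleting blocks and gluing
  ingredients are operations on \<open>E\<close>, and the numbers of common blocks add over disjoint
  edge sets. Plain counting stops one short of the gap: it leaves seven blocks on ten points, and
  this case falls only to a comparison of degrees. For the construction, a total of
  \<open>13 * u\<close> blocks in the groups cannot be undercut by 14 or 15 with planes alone: one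
  plane loses 0 or 8 to 13 blocks, and two that lose anything lose at least 16. This is why
  transversal designs sharing exactly 1 or 2 of their 16 blocks are needed besides the trivial 0 and
  16. A group of 3 points inflated by 4 and extended by one point has 13 points, the size of the
  plane of order 3; with \<open>3 * u * (u - 1) / 4\<close> blocks in the 4-GDD the totals add up to
  \<open>u * (12 * u + 1)\<close>. In the induction for the 4-GDDs, \<open>t = 12 * q + 1\<close> is
  always prime to 6 and congruent to 1 mod 4, so cyclic arrays settle all large orders and only
  finitely many need other means.\<close>

text \<open>A graph is given by its symmetric set of ordered pairs, so that every edge is counted twice.\<close>

definition decomp :: "nat set \<Rightarrow> ('a \<times> 'a) set \<Rightarrow> 'a set set \<Rightarrow> bool" where
  "decomp K E B \<longleftrightarrow>
     (\<forall>b\<in>B. card b \<in> K \<and> 2 \<le> card b) \<and>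
     (\<forall>x y. (x, y) \<in> E \<longleftrightarrow> x \<noteq> y \<and> (\<exists>b\<in>B. x \<in> b \<and> y \<in> b)) \<and>
     (\<forall>b\<in>B. \<forall>c\<in>B. \<forall>x y. x \<noteq> y \<and> x \<in> b \<and> y \<in> b \<and> x \<in> c \<and> y \<in> c \<longrightarrow> b = c)"

definition complete :: "'a set \<Rightarrow> ('a \<times> 'a) set" where
  "complete V = {(x, y). x \<in> V \<and> y \<in> V \<and> x \<noteq> y}"

text \<open>\<open>blow (complete X) W\<close> is the complete multipartite graph with the groups \<open>{x} \<times> W\<close>.\<close>

definition blow :: "('a \<times> 'a) set \<Rightarrow> 'b set \<Rightarrow> (('a \<times> 'b) \<times> ('a \<times> 'b)) set" where
  "blow E W = {((x, i), (y, j)). (x, y) \<in> E \<and> i \<in> W \<and> j \<in> W}"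

lemma decomp_card: "decomp K E B \<Longrightarrow> b \<in> B \<Longrightarrow> card b \<in> K"
  and decomp_card_ge: "decomp K E B \<Longrightarrow> b \<in> B \<Longrightarrow> 2 \<le> card b"
  and decomp_iff: "decomp K E B \<Longrightarrow> (x, y) \<in> E \<longleftrightarrow> x \<noteq> y \<and> (\<exists>b\<in>B. x \<in> b \<and> y \<in> b)"
  by (simp_all add: decomp_def)

lemma decomp_unique:
  "decomp K E B \<Longrightarrow> b \<in> B \<Longrightarrow> c \<in> B \<Longrightarrow> x \<noteq> y \<Longrightarrow> x \<in> b \<Longrightarrow> y \<in> b \<Longrightarrow> x \<in> c \<Longrightarrow> y \<in> c \<Longrightarrow> b = c"
  unfolding decomp_def by blast

lemma card_ge2_obtain:
  assumes "2 \<le> card b"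
  obtains x y where "x \<in> b" "y \<in> b" "x \<noteq> y"
proof -
  have "finite b" using assms by (rule_tac ccontr) simp
  then have "\<not> (\<forall>x\<in>b. \<forall>y\<in>b. x = y)"
    using assms card_le_Suc0_iff_eq[of b] by linarith
  with that show thesis by blast
qed

lemma decomp_partner:
  assumes "decomp K E B" "b \<in> B" "x \<in> b"
  obtains y where "y \<in> b" "(x, y) \<in> E"
proof -
  obtain p q where "p \<in> b" "q \<in> b" "p \<noteq> q"
    using decomp_card_ge[OF assms(1,2)] card_ge2_obtain by blast
  then obtain y where "y \<in> b" "y \<noteq> x" by (cases "p = x") auto
  with that show thesis
    using assms(2,3) decomp_iff[OF assms(1)] by blast
qed

text \<open>A block has at least two points, so each of its points lies on an edge and is visible in
  \<open>E\<close>.\<close>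

lemma decomp_Field:
  assumes "decomp K E B"
  shows "\<Union>B = Field E"
proof (intro set_eqI iffI)
  fix x assume "x \<in> \<Union>B"
  then obtain b where "b \<in> B" "x \<in> b" by blast
  then obtain y where "(x, y) \<in> E" using decomp_partner[OF assms] by blast
  then show "x \<in> Field E" by (rule FieldI1)
next
  fix x assume "x \<in> Field E"
  then obtain y where "(x, y) \<in> E \<or> (y, x) \<in> E" unfolding Field_def by blast
  then show "x \<in> \<Union>B" using decomp_iff[OF assms] by blast
qed

lemma decomp_finite:
  assumes "decomp K E B" "finite E"
  shows "finite B"
proof -
  have "finite (\<Union>B)"
    using assms(2) decomp_Field[OF assms(1)] by (simp add: finite_Field)
  then show ?thesis by (rule finite_UnionD)
qed

lemma decomp_image:
  assumes "decomp K E B" "inj_on f (Field E)"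
  shows "decomp K (map_prod f f ` E) ((`) f ` B)"
proof -
  have sub: "b \<subseteq> Field E" if "b \<in> B" for b
    using decomp_Field[OF assms(1)] that by blast
  have mem: "f x \<in> f ` b \<longleftrightarrow> x \<in> b" if "b \<in> B" "x \<in> Field E" for x b
    by (rule inj_on_image_mem_iff[OF assms(2) that(2) sub[OF that(1)]])
  have c: "card (f ` b) = card b" if "b \<in> B" for b
    by (rule card_image[OF inj_on_subset[OF assms(2) sub[OF that]]])
  have iff: "(x', y') \<in> map_prod f f ` E \<longleftrightarrow> x' \<noteq> y' \<and> (\<exists>b\<in>B. x' \<in> f ` b \<and> y' \<in> f ` b)" for x' y'
  proof
    assume "(x', y') \<in> map_prod f f ` E"
    then obtain x y where xy: "(x, y) \<in> E" "x' = f x" "y' = f y" by auto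
    then obtain b where "x \<noteq> y" "b \<in> B" "x \<in> b" "y \<in> b"
      using decomp_iff[OF assms(1)] by blast
    then show "x' \<noteq> y' \<and> (\<exists>b\<in>B. x' \<in> f ` b \<and> y' \<in> f ` b)"
      using xy inj_onD[OF assms(2), of x y] sub by blast
  next
    assume "x' \<noteq> y' \<and> (\<exists>b\<in>B. x' \<in> f ` b \<and> y' \<in> f ` b)"
    then obtain b x y where "b \<in> B" "x \<in> b" "y \<in> b" "x' = f x" "y' = f y" "x \<noteq> y" by blast
    then show "(x', y') \<in> map_prod f f ` E"
      using decomp_iff[OF assms(1), of x y] by (auto intro!: rev_image_eqI[of "(x, y)"])
  qed
  have uniq: "f ` b = f ` c" if bc: "b \<in> B" "c \<in> B" and
    xy: "x' \<noteq> y'" "x' \<in> f ` b" "y' \<in> f ` b" "x' \<in> f ` c" "y' \<in> f ` c" for b c x' y'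
  proof -
    obtain x y where x: "x \<in> b" "y \<in> b" "x' = f x" "y' = f y" using xy by blast
    then have "x \<in> c" "y \<in> c" using mem[OF bc(2)] sub[OF bc(1)] xy by auto
    then show ?thesis using decomp_unique[OF assms(1) bc, of x y] x xy(1) by blast
  qed
  show ?thesis
    unfolding decomp_def
  proof (intro conjI ballI allI impI)
    fix b assume "b \<in> (`) f ` B"
    then show "card b \<in> K" "2 \<le> card b"
      using decomp_card[OF assms(1)] decomp_card_ge[OF assms(1)] c by auto
  next
    fix b c x y assume "b \<in> (`) f ` B" "c \<in> (`) f ` B" "x \<noteq> y \<and> x \<in> b \<and> y \<in> b \<and> x \<in> c \<and> y \<in> c"
    then show "b = c" using uniq by blast
  next
    fix x y show "(x, y) \<in> map_prod f f ` E \<longleftrightarrow> x \<noteq> y \<and> (\<exists>b\<in>(`) f ` B. x \<in> b \<and> y \<in> b)"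
      using iff by simp
  qed
qed

text \<open>Two blocks sharing two points share an edge, and disjointness of the edge sets puts them
  into the same part.\<close>

lemma decomp_UN:
  assumes d: "\<And>i. i \<in> I \<Longrightarrow> decomp K (E i) (B i)" and disj: "disjoint_family_on E I"
  shows "decomp K (\<Union>i\<in>I. E i) (\<Union>i\<in>I. B i)"
proof -
  have uniq: "b = c" if "i \<in> I" "j \<in> I" "b \<in> B i" "c \<in> B j" "x \<noteq> y" "x \<in> b" "y \<in> b" "x \<in> c" "y \<in> c"
    for i j b c x y
  proof -
    have "(x, y) \<in> E i" "(x, y) \<in> E j"
      using that decomp_iff[OF d] by blast+
    then have "i = j"
      using disj that(1,2) unfolding disjoint_family_on_def by blast
    then show ?thesis using decomp_unique[OF d] that by blast
  qed
  show ?thesis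
    unfolding decomp_def
  proof (intro conjI ballI allI impI)
    fix b assume "b \<in> (\<Union>i\<in>I. B i)"
    then show "card b \<in> K" "2 \<le> card b"
      using decomp_card[OF d] decomp_card_ge[OF d] by auto
  next
    fix b c x y assume "b \<in> (\<Union>i\<in>I. B i)" "c \<in> (\<Union>i\<in>I. B i)"
      "x \<noteq> y \<and> x \<in> b \<and> y \<in> b \<and> x \<in> c \<and> y \<in> c"
    then show "b = c" using uniq by blast
  next
    fix x y show "(x, y) \<in> (\<Union>i\<in>I. E i) \<longleftrightarrow> x \<noteq> y \<and> (\<exists>b\<in>\<Union>i\<in>I. B i. x \<in> b \<and> y \<in> b)"
      using decomp_iff[OF d] by auto
  qed
qed

section \<open>Triples of decompositions with one common pairwise intersection\<close>

definition common3 :: "('a \<times> 'a) set \<Rightarrow> nat set" where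
  "common3 E = {k. \<exists>B1 B2 B3. decomp {4} E B1 \<and> decomp {4} E B2 \<and> decomp {4} E B3 \<and>
     B1 \<inter> B2 = B1 \<inter> B3 \<and> B1 \<inter> B3 = B2 \<inter> B3 \<and> card (B1 \<inter> B2) = k}"

lemma common3I:
  assumes "decomp {4} E B1" "decomp {4} E B2" "decomp {4} E B3"
    "B1 \<inter> B2 = B1 \<inter> B3" "B1 \<inter> B3 = B2 \<inter> B3"
  shows "card (B1 \<inter> B2) \<in> common3 E"
  using assms unfolding common3_def by blast

lemma common3_image:
  assumes "k \<in> common3 E" "inj_on f (Field E)"
  shows "k \<in> common3 (map_prod f f ` E)"
proof -
  obtain B1 B2 B3 where B: "decomp {4} E B1" "decomp {4} E B2" "decomp {4} E B3"
    "B1 \<inter> B2 = B1 \<inter> B3" "B1 \<inter> B3 = B2 \<inter> B3" "card (B1 \<inter> B2) = k"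
    using assms(1) unfolding common3_def by blast
  have inj: "inj_on ((`) f) (B1 \<union> B2 \<union> B3)"
  proof (rule inj_on_subset[OF inj_on_image_Pow[OF assms(2)]])
    show "B1 \<union> B2 \<union> B3 \<subseteq> Pow (Field E)"
      using B(1-3)[THEN decomp_Field] by blast
  qed
  have I: "(`) f ` B1 \<inter> (`) f ` B2 = (`) f ` (B1 \<inter> B2)" "(`) f ` B1 \<inter> (`) f ` B3 = (`) f ` (B1 \<inter> B3)"
    "(`) f ` B2 \<inter> (`) f ` B3 = (`) f ` (B2 \<inter> B3)"
    by (intro inj_on_image_Int[OF inj, symmetric]; blast)+
  have "card ((`) f ` (B1 \<inter> B2)) = k"
    using card_image[OF inj_on_subset[OF inj, of "B1 \<inter> B2"]] B(6) by blast
  moreover have "card ((`) f ` B1 \<inter> (`) f ` B2) \<in> common3 (map_prod f f ` E)"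
    unfolding I by (rule common3I[of _ "(`) f ` B1" "(`) f ` B2" "(`) f ` B3", unfolded I])
      (use B in \<open>simp_all add: decomp_image assms(2)\<close>)
  ultimately show ?thesis using I(1) by simp
qed

text \<open>Every block contains an edge and so belongs to only one of the disjoint graphs.
  Intersections therefore never mix indices, and their sizes add. This is the gluing step of the
  construction.\<close>

lemma common3_UN:
  assumes "finite I" and k: "\<And>i. i \<in> I \<Longrightarrow> k i \<in> common3 (E i)"
    and fin: "\<And>i. i \<in> I \<Longrightarrow> finite (E i)" and disj: "disjoint_family_on E I"
  shows "(\<Sum>i\<in>I. k i) \<in> common3 (\<Union>i\<in>I. E i)"
proof -
  have "\<forall>i\<in>I. \<exists>B1 B2 B3. decomp {4} (E i) B1 \<and> decomp {4} (E i) B2 \<and> decomp {4} (E i) B3 \<and>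
     B1 \<inter> B2 = B1 \<inter> B3 \<and> B1 \<inter> B3 = B2 \<inter> B3 \<and> card (B1 \<inter> B2) = k i"
    using k unfolding common3_def by blast
  from bchoice[OF this] obtain A where "\<forall>i\<in>I. \<exists>B2 B3. decomp {4} (E i) (A i) \<and>
     decomp {4} (E i) B2 \<and> decomp {4} (E i) B3 \<and>
     A i \<inter> B2 = A i \<inter> B3 \<and> A i \<inter> B3 = B2 \<inter> B3 \<and> card (A i \<inter> B2) = k i" ..
  from bchoice[OF this] obtain B where "\<forall>i\<in>I. \<exists>B3. decomp {4} (E i) (A i) \<and>
     decomp {4} (E i) (B i) \<and> decomp {4} (E i) B3 \<and>
     A i \<inter> B i = A i \<inter> B3 \<and> A i \<inter> B3 = B i \<inter> B3 \<and> card (A i \<inter> B i) = k i" ..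
  from bchoice[OF this] obtain C where "\<forall>i\<in>I. decomp {4} (E i) (A i) \<and>
     decomp {4} (E i) (B i) \<and> decomp {4} (E i) (C i) \<and>
     A i \<inter> B i = A i \<inter> C i \<and> A i \<inter> C i = B i \<inter> C i \<and> card (A i \<inter> B i) = k i" ..
  then have d: "\<And>i. i \<in> I \<Longrightarrow> decomp {4} (E i) (A i)"
      "\<And>i. i \<in> I \<Longrightarrow> decomp {4} (E i) (B i)" "\<And>i. i \<in> I \<Longrightarrow> decomp {4} (E i) (C i)"
    and e: "\<And>i. i \<in> I \<Longrightarrow> A i \<inter> B i = A i \<inter> C i" "\<And>i. i \<in> I \<Longrightarrow> A i \<inter> C i = B i \<inter> C i"
      "\<And>i. i \<in> I \<Longrightarrow> card (A i \<inter> B i) = k i"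
    by blast+
  have same: "i = j" if X: "decomp {4} (E i) X" "b \<in> X" and Y: "decomp {4} (E j) Y" "b \<in> Y"
    and "i \<in> I" "j \<in> I" for i j X Y b
  proof -
    obtain x y where "x \<in> b" "y \<in> b" "x \<noteq> y"
      using card_ge2_obtain decomp_card_ge[OF X] by blast
    then have "(x, y) \<in> E i \<inter> E j"
      using X(2) Y(2) decomp_iff[OF X(1)] decomp_iff[OF Y(1)] by blast
    then show ?thesis using disj that(5,6) unfolding disjoint_family_on_def by blast
  qed
  have I: "(\<Union>i\<in>I. X i) \<inter> (\<Union>i\<in>I. Y i) = (\<Union>i\<in>I. X i \<inter> Y i)"
    if "\<And>i. i \<in> I \<Longrightarrow> decomp {4} (E i) (X i)" "\<And>i. i \<in> I \<Longrightarrow> decomp {4} (E i) (Y i)" for X Y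
    using same[OF that(1) _ that(2)] by blast
  have "card (\<Union>i\<in>I. A i \<inter> B i) = (\<Sum>i\<in>I. k i)"
  proof -
    have "card (\<Union>i\<in>I. A i \<inter> B i) = (\<Sum>i\<in>I. card (A i \<inter> B i))"
    proof (intro card_UN_disjoint assms(1) ballI impI)
      show "finite (A i \<inter> B i)" if "i \<in> I" for i
        using decomp_finite[OF d(1) fin] that by simp
      show "A i \<inter> B i \<inter> (A j \<inter> B j) = {}" if "i \<in> I" "j \<in> I" "i \<noteq> j" for i j
        using same[OF d(1) _ d(1)] that by blast
    qed
    then show ?thesis using e(3) by simp
  qed
  moreover have "card ((\<Union>i\<in>I. A i) \<inter> (\<Union>i\<in>I. B i)) \<in> common3 (\<Union>i\<in>I. E i)"
  proof (rule common3I)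
    show "(\<Union>i\<in>I. A i) \<inter> (\<Union>i\<in>I. B i) = (\<Union>i\<in>I. A i) \<inter> (\<Union>i\<in>I. C i)"
      using I[OF d(1,2)] I[OF d(1,3)] e(1) by simp
    show "(\<Union>i\<in>I. A i) \<inter> (\<Union>i\<in>I. C i) = (\<Union>i\<in>I. B i) \<inter> (\<Union>i\<in>I. C i)"
      using I[OF d(1,3)] I[OF d(2,3)] e(2) by simp
  qed (intro decomp_UN d disj; assumption)+
  ultimately show ?thesis using I[OF d(1,2)] by simp
qed

section \<open>Three disjoint decompositions\<close>

lemma decomp_sym: "decomp K E B \<Longrightarrow> (x, y) \<in> E \<Longrightarrow> (y, x) \<in> E"
  using decomp_iff[of K E B x y] decomp_iff[of K E B y x] by blast

lemma decomp_neighbours: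
  assumes "decomp K E B"
  shows "E `` {x} = (\<Union>b\<in>{b\<in>B. x \<in> b}. b - {x})"
  using decomp_iff[OF assms] by auto

text \<open>The blocks through \<open>x\<close>, with \<open>x\<close> removed, partition the
  neighbours of \<open>x\<close> into triples. Hence the number of blocks through a point is
  determined by \<open>E\<close> alone.\<close>

lemma decomp_degree:
  assumes "decomp {4} E B" "finite E"
  shows "card (E `` {x}) = 3 * card {b\<in>B. x \<in> b}"
proof -
  have c: "card (b - {x}) = 3" "finite b" if "b \<in> B" "x \<in> b" for b
  proof -
    show f: "finite b"
      using decomp_card_ge[OF assms(1) that(1)] card.infinite by fastforce
    show "card (b - {x}) = 3"
      using decomp_card[OF assms(1) that(1)] that f by simp
  qed
  have "card (E `` {x}) = (\<Sum>b\<in>{b\<in>B. x \<in> b}. card (b - {x}))"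
    unfolding decomp_neighbours[OF assms(1)]
  proof (intro card_UN_disjoint ballI impI)
    show "(b - {x}) \<inter> (c - {x}) = {}" if "b \<in> {b\<in>B. x \<in> b}" "c \<in> {b\<in>B. x \<in> b}" "b \<noteq> c" for b c
    proof (rule ccontr)
      assume "\<not> ?thesis"
      then obtain y where "y \<noteq> x" "y \<in> b" "y \<in> c" by blast
      then show False using that decomp_unique[OF assms(1), of b c y x] by blast
    qed
  qed (use decomp_finite[OF assms] c in auto)
  also have "\<dots> = (\<Sum>b\<in>{b\<in>B. x \<in> b}. 3)"
    by (intro sum.cong) (use c in auto)
  finally show ?thesis by simp
qed

lemma double_count:
  assumes "finite S" "finite B"
  shows "(\<Sum>x\<in>S. card {b\<in>B. x \<in> b}) = (\<Sum>b\<in>B. card (b \<inter> S))"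
proof -
  have "(\<Sum>x\<in>S. card {b\<in>B. x \<in> b}) = (\<Sum>x\<in>S. \<Sum>b | b \<in> B \<and> x \<in> b. 1)" by simp
  also have "\<dots> = (\<Sum>b\<in>B. \<Sum>x | x \<in> S \<and> x \<in> b. 1)"
    by (rule sum.swap_restrict[OF assms])
  finally show ?thesis by (simp add: Int_def conj_commute)
qed

text \<open>What remains after deleting the common blocks, known as a 3-way trade. Indexing the
  three decompositions lets each argument be stated once for every choice of roles.\<close>

locale trade3 =
  fixes E :: "('a \<times> 'a) set" and T :: "nat \<Rightarrow> 'a set set"
  assumes fin: "finite E"
    and dec: "\<And>i. i < 3 \<Longrightarrow> decomp {4} E (T i)"
    and disj: "\<And>i j. i < 3 \<Longrightarrow> j < 3 \<Longrightarrow> i \<noteq> j \<Longrightarrow> T i \<inter> T j = {}"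
begin

text \<open>The replication number. Defining it by the degree makes it visibly the same for all
  three decompositions; the division is exact.\<close>

definition r :: "'a \<Rightarrow> nat" where
  "r x = card (E `` {x}) div 3"

lemma degree: "card (E `` {x}) = 3 * r x"
  using decomp_degree[OF dec[of 0] fin] by (simp add: r_def)

lemma card_star: "i < 3 \<Longrightarrow> card {b \<in> T i. x \<in> b} = r x"
  using decomp_degree[OF dec fin, of i x] by (simp add: r_def)

lemma finite_T: "i < 3 \<Longrightarrow> finite (T i)"
  using decomp_finite[OF dec fin] .

lemma card_block: "i < 3 \<Longrightarrow> b \<in> T i \<Longrightarrow> card b = 4"
  using decomp_card[OF dec] by blast

lemma finite_block: "i < 3 \<Longrightarrow> b \<in> T i \<Longrightarrow> finite b"
  using card_block card.infinite by fastforce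

lemma edge_in_block: "i < 3 \<Longrightarrow> b \<in> T i \<Longrightarrow> x \<in> b \<Longrightarrow> y \<in> b \<Longrightarrow> x \<noteq> y \<Longrightarrow> (x, y) \<in> E"
  using decomp_iff[OF dec] by blast

lemma block_of_edge:
  assumes "i < 3" "(x, y) \<in> E"
  obtains b where "b \<in> T i" "x \<in> b" "y \<in> b"
  using assms decomp_iff[OF dec] by blast

lemma block_unique:
  "i < 3 \<Longrightarrow> b \<in> T i \<Longrightarrow> c \<in> T i \<Longrightarrow> x \<noteq> y \<Longrightarrow> x \<in> b \<Longrightarrow> y \<in> b \<Longrightarrow> x \<in> c \<Longrightarrow> y \<in> c \<Longrightarrow> b = c"
  using decomp_unique[OF dec] .

text \<open>A block that is alone at \<open>x\<close> consists of \<open>x\<close> and all its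
  neighbours, so it would occur in every decomposition.\<close>

lemma r_ge_2:
  assumes "x \<in> Field E"
  shows "2 \<le> r x"
proof (rule ccontr)
  assume "\<not> 2 \<le> r x"
  then have "r x = 0 \<or> r x = 1" by linarith
  have ex: "\<exists>b\<in>T i. x \<in> b" if "i < 3" for i
    using decomp_Field[OF dec[OF that]] assms by blast
  have star: "\<exists>b. {b \<in> T i. x \<in> b} = {b}" if "i < 3" for i
  proof -
    have "card {b \<in> T i. x \<in> b} \<noteq> 0" using ex[OF that] finite_T[OF that] by auto
    then show ?thesis
      using card_star[OF that] \<open>r x = 0 \<or> r x = 1\<close> by (metis card_1_singletonE)
  qed
  obtain b c where b: "{b \<in> T 0. x \<in> b} = {b}" and c: "{b \<in> T 1. x \<in> b} = {c}"
    using star[of 0] star[of 1] by auto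
  have "b - {x} = c - {x}"
    using decomp_neighbours[OF dec[of 0], of x] decomp_neighbours[OF dec[of 1], of x]
    unfolding b c by simp
  moreover have "x \<in> b" "x \<in> c" "b \<in> T 0" "c \<in> T 1" using b c by blast+
  ultimately have "b = c" by blast
  then show False using disj[of 0 1] \<open>b \<in> T 0\<close> \<open>c \<in> T 1\<close> by auto
qed

text \<open>Pigeonhole: the three other points of \<open>b\<close> are spread over the two blocks of
  \<open>T j\<close> through \<open>p\<close>, so two of them share a block with \<open>p\<close>.
  All four cannot, since \<open>T i\<close> and \<open>T j\<close> are disjoint.\<close>

lemma meets_in_three:
  assumes "i < 3" "j < 3" "i \<noteq> j" "b \<in> T i" "p \<in> b" "r p = 2"
  shows "\<exists>c\<in>T j. p \<in> c \<and> card (b \<inter> c) = 3"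
proof -
  have "\<forall>q\<in>b - {p}. \<exists>c. c \<in> T j \<and> p \<in> c \<and> q \<in> c"
    using edge_in_block[OF assms(1,4,5)] block_of_edge[OF assms(2)] by (metis DiffD1 DiffD2 singletonI)
  from bchoice[OF this] obtain f where f: "\<And>q. q \<in> b - {p} \<Longrightarrow> f q \<in> T j \<and> p \<in> f q \<and> q \<in> f q" by blast
  have "card (f ` (b - {p})) \<le> card {c \<in> T j. p \<in> c}"
    by (intro card_mono) (use f finite_T[OF assms(2)] in auto)
  then have "card (f ` (b - {p})) \<le> 2" using card_star[OF assms(2)] assms(6) by simp
  moreover have "card (b - {p}) = 3"
    using card_block[OF assms(1,4)] finite_block[OF assms(1,4)] assms(5) by simp
  ultimately have "\<not> inj_on f (b - {p})" using card_image[of f "b - {p}"] by linarith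
  then obtain q q' where q: "q \<in> b - {p}" "q' \<in> b - {p}" "q \<noteq> q'" "f q = f q'"
    unfolding inj_on_def by blast
  let ?c = "f q"
  have "{p, q, q'} \<subseteq> b \<inter> ?c" using f[OF q(1)] f[OF q(2)] q assms(5) by auto
  moreover have "card {p, q, q'} = 3" using q by auto
  ultimately have "3 \<le> card (b \<inter> ?c)"
    by (metis card_mono finite_Int finite_block[OF assms(1,4)])
  moreover have "card (b \<inter> ?c) \<noteq> 4"
  proof
    assume *: "card (b \<inter> ?c) = 4"
    have "b \<inter> ?c = b" "b \<inter> ?c = ?c"
      using * f[OF q(1)] assms card_block finite_block by (metis card_subset_eq inf_le1, metis card_subset_eq inf_le2)
    then have "b = ?c" by simp
    then show False using disj[OF assms(1,2,3)] assms(4) f[OF q(1)] by blast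
  qed
  moreover have "card (b \<inter> ?c) \<le> 4"
    using card_mono[OF finite_block[OF assms(1,4)], of "b \<inter> ?c"] card_block[OF assms(1,4)] by simp
  ultimately have "card (b \<inter> ?c) = 3" by linarith
  then show ?thesis using f[OF q(1)] by blast
qed

text \<open>Two triples inside a 4-set share two points, so only one block of \<open>T j\<close> can
  meet \<open>b\<close> in a triple. It therefore serves all points of \<open>b\<close> of
  replication 2 at once.\<close>

lemma meets_in_three_all:
  assumes "i < 3" "j < 3" "i \<noteq> j" "b \<in> T i" "p \<in> b" "r p = 2"
  obtains c where "c \<in> T j" "card (b \<inter> c) = 3" "\<And>x. x \<in> b \<Longrightarrow> r x = 2 \<Longrightarrow> x \<in> c"
proof -
  obtain c where c: "c \<in> T j" "p \<in> c" "card (b \<inter> c) = 3"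
    using meets_in_three[OF assms] by blast
  moreover have "x \<in> c" if x: "x \<in> b" "r x = 2" for x
  proof -
    obtain d where d: "d \<in> T j" "x \<in> d" "card (b \<inter> d) = 3"
      using meets_in_three[OF assms(1-4) x] by blast
    have fb: "finite b" using finite_block[OF assms(1,4)] .
    have "card (b \<inter> c \<union> b \<inter> d) \<le> 4"
      using card_mono[OF fb, of "b \<inter> c \<union> b \<inter> d"] card_block[OF assms(1,4)] by auto
    then have "2 \<le> card ((b \<inter> c) \<inter> (b \<inter> d))"
      using card_Un_Int[of "b \<inter> c" "b \<inter> d"] c(3) d(3) fb by simp
    then obtain y z where "y \<in> (b \<inter> c) \<inter> (b \<inter> d)" "z \<in> (b \<inter> c) \<inter> (b \<inter> d)" "y \<noteq> z"
      using card_ge2_obtain by blast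
    then have "c = d" using block_unique[OF assms(2) c(1) d(1), of y z] by blast
    then show ?thesis using d by simp
  qed
  ultimately show thesis using that by blast
qed

section \<open>Local structure at points of replication 2\<close>

lemma star_two:
  assumes "i < 3" "b \<in> T i" "e \<in> T i" "b \<noteq> e" "x \<in> b" "x \<in> e" "r x = 2"
  shows "{c \<in> T i. x \<in> c} = {b, e}"
proof (rule sym, rule card_subset_eq)
  show "finite {c \<in> T i. x \<in> c}" using finite_T[OF assms(1)] by simp
  show "{b, e} \<subseteq> {c \<in> T i. x \<in> c}" using assms by blast
  show "card {b, e} = card {c \<in> T i. x \<in> c}" using assms card_star[OF assms(1)] by simp
qed

text \<open>The two blocks at \<open>x\<close> cover all its neighbours, so those outside
  \<open>b\<close> are all on the other block.\<close>

lemma second_block: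
  assumes "i < 3" "b \<in> T i" "x \<in> b" "r x = 2" "(x, s) \<in> E" "(x, t) \<in> E" "s \<notin> b" "t \<notin> b"
  obtains e where "e \<in> T i" "e \<noteq> b" "x \<in> e" "s \<in> e" "t \<in> e"
proof -
  obtain e where e: "e \<in> T i" "x \<in> e" "s \<in> e" using block_of_edge[OF assms(1,5)] by blast
  obtain d where d: "d \<in> T i" "x \<in> d" "t \<in> d" using block_of_edge[OF assms(1,6)] by blast
  have "{c \<in> T i. x \<in> c} = {b, e}"
    using star_two[OF assms(1,2) e(1) _ assms(3) e(2) assms(4)] e(3) assms(7) by blast
  then have "d = e" using d assms(8) by blast
  then show thesis using that[of e] e d assms(7) by blast
qed

text \<open>If \<open>s\<close> and \<open>t\<close> differed, the second block at \<open>x\<close>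
  and the second block at \<open>y\<close> would both contain them and thus coincide. That block
  would contain \<open>x\<close> and \<open>y\<close>, as \<open>b\<close> does.\<close>

lemma common_outer_neighbour:
  assumes "i < 3" "b \<in> T i" "x \<in> b" "y \<in> b" "x \<noteq> y" "r x = 2" "r y = 2"
    and "(x, s) \<in> E" "(y, s) \<in> E" "(x, t) \<in> E" "(y, t) \<in> E" "s \<notin> b" "t \<notin> b"
  shows "s = t"
proof (rule ccontr)
  assume "s \<noteq> t"
  obtain e where e: "e \<in> T i" "e \<noteq> b" "x \<in> e" "s \<in> e" "t \<in> e"
    using second_block[OF assms(1,2,3,6,8,10,12,13)] .
  obtain d where d: "d \<in> T i" "d \<noteq> b" "y \<in> d" "s \<in> d" "t \<in> d"
    using second_block[OF assms(1,2,4,7,9,11,12,13)] .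
  have "e = d" using block_unique[OF assms(1) e(1) d(1) \<open>s \<noteq> t\<close>] e d by blast
  then show False using block_unique[OF assms(1) e(1) assms(2,5)] e d assms(3,4) by blast
qed

lemma outer_point:
  assumes "i < 3" "j < 3" "b \<in> T i" "c \<in> T j" "card (b \<inter> c) = 3"
  obtains s where "c - b = {s}"
proof -
  have "card (c - b) = 1"
    using card_Diff_subset_Int[of c b] card_block[OF assms(2,4)] assms(5) finite_block[OF assms(1,3)]
    by (simp add: Int_commute)
  then show thesis using that by (rule card_1_singletonE)
qed

text \<open>With equal traces, \<open>c\<close> and \<open>d\<close> each have one point outside
  \<open>b\<close>, and both of these points are adjacent to \<open>x\<close> and \<open>y\<close>.
  By \<open>common_outer_neighbour\<close> they are the same point, and \<open>c = d\<close>
  contradicts disjointness.\<close>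

lemma different_traces:
  assumes "i < 3" "j < 3" "k < 3" "i \<noteq> j" "i \<noteq> k" "j \<noteq> k" "b \<in> T i" "c \<in> T j" "d \<in> T k"
    and "card (b \<inter> c) = 3" "x \<in> b \<inter> c" "y \<in> b \<inter> c" "x \<noteq> y" "r x = 2" "r y = 2"
  shows "b \<inter> c \<noteq> b \<inter> d"
proof
  assume eq: "b \<inter> c = b \<inter> d"
  obtain s where s: "c - b = {s}" using outer_point[OF assms(1,2,7,8,10)] .
  obtain t where t: "d - b = {t}" using outer_point[OF assms(1,3,7,9)] assms(10) eq by metis
  have "s = t"
  proof (rule common_outer_neighbour[OF assms(1,7) _ _ assms(13-15)])
    show "(x, s) \<in> E" "(y, s) \<in> E"
      using edge_in_block[OF assms(2,8)] s assms(11,12) by blast+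
    show "(x, t) \<in> E" "(y, t) \<in> E"
      using edge_in_block[OF assms(3,9)] t assms(11,12) eq by blast+
  qed (use assms(11,12) s t in blast)+
  then have "c = d" using s t eq by blast
  then show False using disj[OF assms(2,3,6)] assms(8,9) by blast
qed

lemma two_others: "(i::nat) < 3 \<Longrightarrow> \<exists>j k. j < 3 \<and> k < 3 \<and> i \<noteq> j \<and> i \<noteq> k \<and> j \<noteq> k"
proof -
  assume "i < 3"
  then consider "i = 0" | "i = 1" | "i = 2" by linarith
  then show ?thesis
  proof cases
    case 1 then show ?thesis by (intro exI[of _ 1] exI[of _ 2]) simp
  next
    case 2 then show ?thesis by (intro exI[of _ 0] exI[of _ 2]) simp
  next
    case 3 then show ?thesis by (intro exI[of _ 0] exI[of _ 1]) simp
  qed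
qed

text \<open>Three points of replication 2 would make up the whole triple in which a block of each
  other decomposition meets \<open>b\<close>, against \<open>different_traces\<close>.\<close>

lemma at_most_two:
  assumes "i < 3" "b \<in> T i"
  shows "card {x \<in> b. r x = 2} \<le> 2"
proof (rule ccontr)
  let ?R = "{x \<in> b. r x = 2}"
  assume "\<not> ?thesis"
  then have 3: "3 \<le> card ?R" by simp
  then have "2 \<le> card ?R" by simp
  then obtain x y where x: "x \<in> ?R" "y \<in> ?R" "x \<noteq> y" using card_ge2_obtain by blast
  obtain j k where jk: "j < 3" "k < 3" "i \<noteq> j" "i \<noteq> k" "j \<noteq> k" using two_others[OF assms(1)] by blast
  obtain c where c: "c \<in> T j" "card (b \<inter> c) = 3" "\<And>x. x \<in> b \<Longrightarrow> r x = 2 \<Longrightarrow> x \<in> c"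
    using meets_in_three_all[OF assms(1) jk(1,3) assms(2), of x] x by blast
  obtain d where d: "d \<in> T k" "card (b \<inter> d) = 3" "\<And>x. x \<in> b \<Longrightarrow> r x = 2 \<Longrightarrow> x \<in> d"
    using meets_in_three_all[OF assms(1) jk(2,4) assms(2), of x] x by blast
  have fb: "finite b" using finite_block[OF assms] .
  have "?R = b \<inter> c" by (rule card_seteq) (use c 3 fb in auto)
  moreover have "?R = b \<inter> d" by (rule card_seteq) (use d 3 fb in auto)
  ultimately show False
    using different_traces[OF assms(1) jk(1,2,3,4,5) assms(2) c(1) d(1) c(2), of x y] x by blast
qed

text \<open>If the four points of \<open>b\<close> are \<open>x, y, A, B\<close> with \<open>x, y\<close> of replication 2, the other two
  decompositions contain \<open>x y A s\<close> and \<open>x y B s\<close> with the same \<open>s\<close>, and this forces their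
  remaining blocks at \<open>x\<close> to meet \<open>e\<close> in the same triple \<open>e - {s}\<close>.\<close>

lemma isolated_in_second_block:
  assumes "i < 3" "b \<in> T i" "e \<in> T i" "b \<noteq> e" "x \<in> b" "x \<in> e" "r x = 2"
    and "y \<in> b" "y \<noteq> x" "r y = 2" "p \<in> e" "p \<noteq> x"
  shows "r p \<noteq> 2"
proof
  assume rp: "r p = 2"
  obtain j k where jk: "j < 3" "k < 3" "i \<noteq> j" "i \<noteq> k" "j \<noteq> k" using two_others[OF assms(1)] by blast
  have be: "z = x" if "z \<in> b" "z \<in> e" for z
    using block_unique[OF assms(1-3), of x z] that assms(4-6) by blast
  have trace: "\<exists>c s c'. c \<in> T j \<and> x \<in> c \<and> y \<in> c \<and> s \<in> c \<and> s \<notin> b \<and> c' \<in> T j \<and> x \<in> c' \<and> p \<in> c' \<and>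
      card (e \<inter> c') = 3 \<and> e \<inter> c' = e - {s}"
    if j: "j < 3" "i \<noteq> j" for j
  proof -
    obtain c where c: "c \<in> T j" "card (b \<inter> c) = 3" "\<And>x. x \<in> b \<Longrightarrow> r x = 2 \<Longrightarrow> x \<in> c"
      using meets_in_three_all[OF assms(1) j assms(2,5,7)] by blast
    obtain c' where c': "c' \<in> T j" "card (e \<inter> c') = 3" "\<And>x. x \<in> e \<Longrightarrow> r x = 2 \<Longrightarrow> x \<in> c'"
      using meets_in_three_all[OF assms(1) j assms(3,6,7)] by blast
    obtain s where s: "c - b = {s}" using outer_point[OF assms(1) j(1) assms(2) c(1,2)] .
    have x: "x \<in> c" "x \<in> c'" "y \<in> c" "p \<in> c'" using assms rp c(3) c'(3) by blast+
    \<comment> \<open>\<open>b\<close> and \<open>e\<close> meet only in \<open>x\<close>, so a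
      block with three points on \<open>b\<close> has at most \<open>x\<close> and its outer point
      \<open>s\<close> on \<open>e\<close>.\<close>
    have "c \<noteq> c'"
    proof
      assume "c = c'"
      then have "e \<inter> c' \<subseteq> {x, s}" using s be by blast
      then have "card (e \<inter> c') \<le> card {x, s}" by (intro card_mono) auto
      also have "\<dots> \<le> 2" by (simp add: card_insert_if)
      finally show False using c'(2) by simp
    qed
    then have star: "{z \<in> T j. x \<in> z} = {c, c'}"
      using star_two[OF j(1) c(1) c'(1)] x assms(7) by blast
    have cc': "z = x" if "z \<in> c" "z \<in> c'" for z
      using block_unique[OF j(1) c(1) c'(1), of x z] that x \<open>c \<noteq> c'\<close> by blast
    \<comment> \<open>\<open>c\<close> and \<open>c'\<close> cover all neighbours of
      \<open>x\<close>, and \<open>c\<close> contains no point of \<open>e\<close> other than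
      \<open>x\<close> and possibly \<open>s\<close>.\<close>
    have "e - {s} \<subseteq> c'"
    proof
      fix z assume z: "z \<in> e - {s}"
      show "z \<in> c'"
      proof (cases "z = x")
        case False
        then obtain g where "g \<in> T j" "x \<in> g" "z \<in> g"
          using edge_in_block[OF assms(1,3), of x z] block_of_edge[OF j(1)] z assms(6) by blast
        then have "z \<in> c \<or> z \<in> c'" using star by blast
        moreover have "z \<notin> c" using s z be False by blast
        ultimately show ?thesis by simp
      qed (use x in simp)
    qed
    moreover have "s \<notin> c'" using cc'[of s] s assms(5) by blast
    ultimately have "e \<inter> c' = e - {s}" by blast
    then show ?thesis using c c' x s by blast
  qed
  obtain c s c' where c: "c \<in> T j" "x \<in> c" "y \<in> c" "s \<in> c" "s \<notin> b" "c' \<in> T j" "x \<in> c'" "p \<in> c'"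
    "card (e \<inter> c') = 3" "e \<inter> c' = e - {s}"
    using trace[OF jk(1,3)] by blast
  obtain d t d' where d: "d \<in> T k" "x \<in> d" "y \<in> d" "t \<in> d" "t \<notin> b" "d' \<in> T k" "x \<in> d'" "p \<in> d'"
    "card (e \<inter> d') = 3" "e \<inter> d' = e - {t}"
    using trace[OF jk(2,4)] by blast
  have "s = t"
  proof (rule common_outer_neighbour[OF assms(1,2,5,8) _ assms(7,10)])
    show "(x, s) \<in> E" "(y, s) \<in> E"
      using edge_in_block[OF jk(1) c(1)] c assms(5,8) by blast+
    show "(x, t) \<in> E" "(y, t) \<in> E"
      using edge_in_block[OF jk(2) d(1)] d assms(5,8) by blast+
  qed (use c d assms(9) in auto)
  then have "e \<inter> c' = e \<inter> d'" using c d by simp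
  moreover have "x \<in> e \<inter> c'" "p \<in> e \<inter> c'" using c assms(6,11) by blast+
  ultimately show False
    using different_traces[OF assms(1) jk(1-5) assms(3) c(6) d(6) c(9)] assms(7,12) rp by metis
qed

text \<open>For \<open>m\<close> blocks, \<open>n\<close> points, \<open>a\<close> points of
  replication 2 and the set \<open>D\<close> of blocks with two such points,
  \<open>2 * card D \<le> a\<close> and \<open>2 * a \<le> m + card D\<close> yield
  \<open>3 * a \<le> 2 * m\<close>. The other points have replication at least 3, whence
  \<open>3 * n \<le> 4 * m + a\<close>. Together with \<open>n \<ge> 10\<close> only
  \<open>m = 7\<close>, \<open>n = 10\<close> survives below 8.\<close>

lemma volume_ge_8:
  assumes "T 0 \<noteq> {}"
  shows "8 \<le> card (T 0)"
proof -
  define F where "F = Field E"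
  define R where "R = {x \<in> F. r x = 2}"
  define D where "D = {b \<in> T 0. card (b \<inter> R) = 2}"
  define m n a where "m = card (T 0)" and "n = card F" and "a = card R"
  have 0: "(0::nat) < 3" by simp
  have finF: "finite F" using fin by (simp add: F_def finite_Field)
  then have finR: "finite R" by (simp add: R_def)
  have finT: "finite (T 0)" "finite D" using finite_T[OF 0] by (auto simp: D_def)
  have RF: "R \<subseteq> F" by (auto simp: R_def)
  have sub: "b \<subseteq> F" if "b \<in> T 0" for b
    using decomp_Field[OF dec[OF 0]] that unfolding F_def by blast
  have bR: "b \<inter> R = {x \<in> b. r x = 2}" if "b \<in> T 0" for b
    using sub[OF that] by (auto simp: R_def)
  have sumr: "(\<Sum>x\<in>F. r x) = 4 * m"
  proof -
    have "(\<Sum>x\<in>F. r x) = (\<Sum>b\<in>T 0. card (b \<inter> F))"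
      using double_count[OF finF finT(1)] by (simp add: card_star[OF 0])
    also have "\<dots> = (\<Sum>b\<in>T 0. 4)"
      by (intro sum.cong) (use sub card_block[OF 0] in \<open>auto simp: Int_absorb2\<close>)
    finally show ?thesis by (simp add: m_def)
  qed
  have "2 * card D \<le> a"
  proof -
    \<comment> \<open>Two blocks of \<open>D\<close> at \<open>x\<close> would each carry a further
      point of replication 2, which \<open>isolated_in_second_block\<close> forbids.\<close>
    have le1: "card {b \<in> D. x \<in> b} \<le> 1" if x: "x \<in> R" for x
    proof (rule ccontr)
      assume "\<not> ?thesis"
      then have "2 \<le> card {b \<in> D. x \<in> b}" by simp
      then obtain b e where be: "b \<in> {b \<in> D. x \<in> b}" "e \<in> {b \<in> D. x \<in> b}" "b \<noteq> e"
        using card_ge2_obtain by blast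
      have other: "\<exists>y\<in>b. y \<noteq> x \<and> r y = 2" if "b \<in> D" for b
      proof -
        have "2 \<le> card (b \<inter> R)" using that by (simp add: D_def)
        then obtain y z where "y \<in> b \<inter> R" "z \<in> b \<inter> R" "y \<noteq> z" using card_ge2_obtain by blast
        then show ?thesis by (cases "y = x") (auto simp: R_def)
      qed
      obtain y p where "y \<in> b" "y \<noteq> x" "r y = 2" "p \<in> e" "p \<noteq> x" "r p = 2"
        using other[of b] other[of e] be by blast
      then show False
        using isolated_in_second_block[OF 0, of b e x y p] be x by (auto simp: D_def R_def)
    qed
    have "2 * card D = (\<Sum>b\<in>D. card (b \<inter> R))"
      by (simp add: D_def)
    also have "\<dots> = (\<Sum>x\<in>R. card {b \<in> D. x \<in> b})"
      by (rule double_count[OF finR finT(2), symmetric])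
    also have "\<dots> \<le> (\<Sum>x\<in>R. 1)" by (intro sum_mono le1)
    finally show ?thesis by (simp add: a_def)
  qed
  moreover have "2 * a \<le> m + card D"
  proof -
    have "2 * a = (\<Sum>x\<in>R. r x)" by (simp add: R_def a_def)
    also have "\<dots> = (\<Sum>b\<in>T 0. card (b \<inter> R))"
      using double_count[OF finR finT(1)] by (simp add: card_star[OF 0])
    also have "\<dots> \<le> (\<Sum>b\<in>T 0. 1 + (if b \<in> D then 1 else 0))"
    proof (rule sum_mono)
      fix b assume b: "b \<in> T 0"
      have "card (b \<inter> R) \<le> 2" using at_most_two[OF 0 b] bR[OF b] by simp
      then show "card (b \<inter> R) \<le> 1 + (if b \<in> D then 1 else 0)" using b by (auto simp: D_def)
    qed
    also have "\<dots> = m + card D"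
    proof -
      have "T 0 \<inter> D = D" by (auto simp: D_def)
      then show ?thesis
        using finT by (simp add: sum_Suc m_def sum.If_cases)
    qed
    finally show ?thesis .
  qed
  ultimately have a: "3 * a \<le> 2 * m" by linarith
  have split: "(\<Sum>x\<in>F. r x) = 2 * a + (\<Sum>x\<in>F - R. r x)"
    using sum.subset_diff[OF RF finF, of r] by (simp add: R_def a_def)
  have r3: "3 \<le> r x" if "x \<in> F - R" for x
    using r_ge_2[of x] that by (auto simp: F_def R_def)
  have cFR: "card (F - R) + a = n"
    using card_Diff_subset[OF finR RF] card_mono[OF finF RF] by (simp add: n_def a_def)
  have "(\<Sum>x\<in>F - R. 3) \<le> (\<Sum>x\<in>F - R. r x)" by (intro sum_mono r3)
  then have nm: "3 * n \<le> 4 * m + a" using sumr split cFR by simp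
  have deg: "3 * r x + 1 \<le> n" if "x \<in> F" for x
  proof -
    have "E `` {x} \<subseteq> F - {x}"
      using decomp_iff[OF dec[OF 0]] unfolding F_def by (auto intro: FieldI2)
    then have "card (E `` {x}) \<le> card (F - {x})" using finF by (intro card_mono) auto
    then show ?thesis using degree[of x] that finF by (simp add: n_def) (metis One_nat_def Suc_pred card_gt_0_iff Suc_le_mono empty_iff)
  qed
  \<comment> \<open>Some point of any block has replication at least 3 and hence at least nine
    neighbours.\<close>
  have n10: "10 \<le> n"
  proof -
    obtain b where b: "b \<in> T 0" using assms by blast
    have "\<exists>x\<in>b. r x \<noteq> 2"
    proof (rule ccontr)
      assume "\<not> ?thesis"
      then have "{x \<in> b. r x = 2} = b" by blast
      then show False using at_most_two[OF 0 b] card_block[OF 0 b] by simp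
    qed
    then obtain x where x: "x \<in> b" "r x \<noteq> 2" by blast
    then have "x \<in> F - R" using sub[OF b] by (auto simp: R_def)
    then show ?thesis using r3[of x] deg[of x] by simp
  qed
  show ?thesis
  proof (rule ccontr)
    assume "\<not> ?thesis"
    then have "m \<le> 7" by (simp add: m_def)
    \<comment> \<open>\<open>30 \<le> 4 * m + a\<close> and \<open>3 * a \<le> 2 * m\<close> force
      \<open>m \<ge> 7\<close>; then \<open>a \<le> 4\<close> and
      \<open>3 * n \<le> 32\<close>.\<close>
    then have m: "m = 7" and n: "n = 10" using a nm n10 by linarith+
    have r3': "r x = 3" if "x \<in> F - R" for x
      using r3[OF that] deg[of x] that n by simp
    then have "(\<Sum>x\<in>F - R. r x) = 3 * card (F - R)" by simp
    \<comment> \<open>Incidences: \<open>28 = 2 * a + 3 * (10 - a)\<close>.\<close>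
    then have a2: "a = 2" using sumr split cFR m n by simp
    then obtain x where x: "x \<in> R" using finR unfolding a_def by fastforce
    \<comment> \<open>The eight points outside \<open>R\<close> have degree 9 among ten points, so
      all are adjacent to \<open>x\<close>, whose degree is only 6.\<close>
    have "F - R \<subseteq> E `` {x}"
    proof
      fix y assume y: "y \<in> F - R"
      have "E `` {y} \<subseteq> F - {y}"
        using decomp_iff[OF dec[OF 0]] unfolding F_def by (auto intro: FieldI2)
      moreover have "card (E `` {y}) = card (F - {y})"
        using degree[of y] r3'[OF y] y n finF by (simp add: n_def)
      ultimately have "E `` {y} = F - {y}" using finF by (intro card_subset_eq) auto
      then have "(y, x) \<in> E" using x y RF by blast
      then show "y \<in> E `` {x}" using decomp_sym[OF dec[OF 0]] by blast
    qed
    moreover have "finite (E `` {x})" using fin by (rule finite_Image)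
    ultimately have "card (F - R) \<le> card (E `` {x})" by (rule card_mono[rotated])
    then show False using degree[of x] x cFR a2 n by (simp add: R_def)
  qed
qed

end

section \<open>The gap below the number of blocks\<close>

lemma Field_complete: "Field (complete V) \<subseteq> V"
  by (auto simp: complete_def Field_def)

lemma finite_complete: "finite V \<Longrightarrow> finite (complete V)"
  by (rule finite_subset[of _ "V \<times> V"]) (auto simp: complete_def)

lemma card_complete:
  assumes "finite V"
  shows "card (complete V) = card V * (card V - 1)"
proof -
  have "complete V = Sigma V (\<lambda>x. V - {x})" by (auto simp: complete_def)
  then show ?thesis using assms by simp
qed

lemma image_complete:
  assumes "inj_on f V"
  shows "map_prod f f ` complete V = complete (f ` V)"
proof
  show "map_prod f f ` complete V \<subseteq> complete (f ` V)"
    using inj_onD[OF assms] by (fastforce simp: complete_def)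
  show "complete (f ` V) \<subseteq> map_prod f f ` complete V"
  proof clarify
    fix x' y' assume "(x', y') \<in> complete (f ` V)"
    then obtain x y where "x \<in> V" "y \<in> V" "x' = f x" "y' = f y" "x \<noteq> y"
      by (auto simp: complete_def)
    then show "(x', y') \<in> map_prod f f ` complete V"
      by (intro image_eqI[of _ _ "(x, y)"]) (auto simp: complete_def)
  qed
qed

lemma decomp_eq_UN_complete: "decomp K E B \<Longrightarrow> E = (\<Union>b\<in>B. complete b)"
  using decomp_iff[of K E B] by (auto simp: complete_def)

lemma decomp_disjoint_complete: "decomp K E B \<Longrightarrow> disjoint_family_on complete B"
  unfolding disjoint_family_on_def complete_def using decomp_unique[of K E B] by blast

text \<open>\<open>E\<close> consists of ordered pairs, so a 4-clique accounts for 12 of its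
  elements.\<close>

lemma card_decomp4:
  assumes "decomp {4} E B" "finite E"
  shows "card E = 12 * card B"
proof -
  have fb: "finite b" if "b \<in> B" for b
    using decomp_card_ge[OF assms(1) that] card.infinite by fastforce
  have "card E = (\<Sum>b\<in>B. card (complete b))"
    unfolding decomp_eq_UN_complete[OF assms(1)]
    using decomp_disjoint_complete[OF assms(1)] decomp_finite[OF assms] finite_complete[OF fb]
    by (intro card_UN_disjoint) (auto simp: disjoint_family_on_def)
  also have "\<dots> = (\<Sum>b\<in>B. 12)"
    by (intro sum.cong) (use decomp_card[OF assms(1)] fb in \<open>simp_all add: card_complete\<close>)
  finally show ?thesis by simp
qed

section \<open>From designs to decompositions of complete graphs, and the first inclusion\<close>

lemma S24_design_iff: "S24_design v V B \<longleftrightarrow> finite V \<and> card V = v \<and> decomp {4} (complete V) B"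
proof
  assume *: "S24_design v V B"
  then have b: "b \<subseteq> V" "card b = 4" if "b \<in> B" for b
    using that by (auto simp: S24_design_def)
  have ex1: "\<exists>!b. b \<in> B \<and> {x, y} \<subseteq> b" if "x \<in> V" "y \<in> V" "x \<noteq> y" for x y
  proof -
    have "\<exists>!b. b \<in> B \<and> P \<subseteq> b" if "P \<subseteq> V \<and> card P = 2" for P
      using * that unfolding S24_design_def by simp
    moreover have "{x, y} \<subseteq> V \<and> card {x, y} = 2" using that by simp
    ultimately show ?thesis .
  qed
  have "decomp {4} (complete V) B"
    unfolding decomp_def
  proof (intro conjI ballI allI impI)
    fix x y show "(x, y) \<in> complete V \<longleftrightarrow> x \<noteq> y \<and> (\<exists>b\<in>B. x \<in> b \<and> y \<in> b)"
    proof
      assume "(x, y) \<in> complete V"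
      then show "x \<noteq> y \<and> (\<exists>b\<in>B. x \<in> b \<and> y \<in> b)"
        using ex1[of x y] by (auto simp: complete_def)
    next
      assume "x \<noteq> y \<and> (\<exists>b\<in>B. x \<in> b \<and> y \<in> b)"
      then show "(x, y) \<in> complete V" using b(1) by (auto simp: complete_def)
    qed
  next
    fix c d x y assume "c \<in> B" "d \<in> B" "x \<noteq> y \<and> x \<in> c \<and> y \<in> c \<and> x \<in> d \<and> y \<in> d"
    moreover from this have "\<exists>!b. b \<in> B \<and> {x, y} \<subseteq> b" using b(1) by (intro ex1) auto
    ultimately show "c = d" by blast
  qed (use b(2) in auto)
  then show "finite V \<and> card V = v \<and> decomp {4} (complete V) B"
    using * by (simp add: S24_design_def)
next
  assume *: "finite V \<and> card V = v \<and> decomp {4} (complete V) B"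
  then have d: "decomp {4} (complete V) B" by simp
  have sub: "b \<subseteq> V" if "b \<in> B" for b
    using decomp_Field[OF d] Field_complete[of V] that by blast
  have ex1: "\<exists>!b. b \<in> B \<and> P \<subseteq> b" if P: "P \<subseteq> V" "card P = 2" for P
  proof -
    obtain x y where xy: "P = {x, y}" "x \<noteq> y" using P(2) card_2_iff by metis
    then have "(x, y) \<in> complete V" using P(1) by (simp add: complete_def)
    then obtain b where "b \<in> B" "x \<in> b" "y \<in> b" using decomp_iff[OF d] by blast
    then show ?thesis
      using decomp_unique[OF d _ _ xy(2)] xy(1) by blast
  qed
  show "S24_design v V B"
    unfolding S24_design_def
  proof (intro conjI ballI allI impI)
    show "card b = 4" if "b \<in> B" for b using decomp_card[OF d that] by simp
  qed (use * sub ex1 in simp_all)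
qed

text \<open>Deleting a block deletes exactly its own edges, because no other block contains any of
  them.\<close>

lemma decomp_diff:
  assumes "decomp K E B" "C \<subseteq> B"
  shows "decomp K (E - (\<Union>b\<in>C. complete b)) (B - C)"
  unfolding decomp_def
proof (intro conjI ballI allI impI)
  fix x y show "(x, y) \<in> E - (\<Union>b\<in>C. complete b) \<longleftrightarrow> x \<noteq> y \<and> (\<exists>b\<in>B - C. x \<in> b \<and> y \<in> b)"
  proof
    assume "(x, y) \<in> E - (\<Union>b\<in>C. complete b)"
    then show "x \<noteq> y \<and> (\<exists>b\<in>B - C. x \<in> b \<and> y \<in> b)"
      using decomp_iff[OF assms(1), of x y] by (auto simp: complete_def)
  next
    assume "x \<noteq> y \<and> (\<exists>b\<in>B - C. x \<in> b \<and> y \<in> b)"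
    then obtain b where b: "x \<noteq> y" "b \<in> B" "b \<notin> C" "x \<in> b" "y \<in> b" by blast
    then have "(x, y) \<notin> complete c" if "c \<in> C" for c
      using decomp_unique[OF assms(1), of b c x y] that assms(2) by (auto simp: complete_def)
    then show "(x, y) \<in> E - (\<Union>b\<in>C. complete b)"
      using decomp_iff[OF assms(1), of x y] b by blast
  qed
next
  fix b c x y assume "b \<in> B - C" "c \<in> B - C" "x \<noteq> y \<and> x \<in> b \<and> y \<in> b \<and> x \<in> c \<and> y \<in> c"
  then show "b = c" using decomp_unique[OF assms(1), of b c x y] by blast
qed (use decomp_card[OF assms(1)] decomp_card_ge[OF assms(1)] in auto)

text \<open>The common blocks belong to all three decompositions, so deleting them leaves the same
  graph each time, decomposed in three disjoint ways. Either nothing is left or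
  \<open>volume_ge_8\<close> applies.\<close>

lemma common3_gap:
  assumes "k \<in> common3 E" "finite E" "card E = 12 * n"
  shows "k = n \<or> k + 8 \<le> n"
proof -
  obtain B1 B2 B3 where B: "decomp {4} E B1" "decomp {4} E B2" "decomp {4} E B3"
    and I: "B1 \<inter> B2 = B1 \<inter> B3" "B1 \<inter> B3 = B2 \<inter> B3" and k: "card (B1 \<inter> B2) = k"
    using assms(1) unfolding common3_def by blast
  define C where "C = B1 \<inter> B2"
  have sub: "C \<subseteq> B1" "C \<subseteq> B2" "C \<subseteq> B3" using I by (auto simp: C_def)
  define T where "T i = (if i = 0 then B1 else if i = (1::nat) then B2 else B3) - C" for i
  interpret trade3 "E - (\<Union>b\<in>C. complete b)" T
  proof
    show "decomp {4} (E - (\<Union>b\<in>C. complete b)) (T i)" if "i < 3" for i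
      using B sub by (simp add: T_def decomp_diff)
    show "T i \<inter> T j = {}" if "i < 3" "j < 3" "i \<noteq> j" for i j
      using that I unfolding T_def C_def by (simp split: if_splits) blast+
  qed (use assms(2) in simp)
  have fin: "finite B1" using decomp_finite[OF B(1) assms(2)] .
  have "card B1 = n" using card_decomp4[OF B(1) assms(2)] assms(3) by simp
  then have n: "card (T 0) + k = n"
    using card_Diff_subset[OF finite_subset[OF sub(1) fin] sub(1)] card_mono[OF fin sub(1)] k
    by (simp add: T_def C_def)
  show ?thesis
  proof (cases "T 0 = {}")
    case True
    then show ?thesis using n by simp
  next
    case False
    then show ?thesis using volume_ge_8 n by simp
  qed
qed

lemma J3_eq: "J3 v = int ` (\<Union>V\<in>{V :: nat set. finite V \<and> card V = v}. common3 (complete V))"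
proof (intro set_eqI iffI)
  fix k assume "k \<in> J3 v"
  then obtain V :: "nat set" and B1 B2 B3 where V: "finite V" "card V = v"
    and "decomp {4} (complete V) B1" "decomp {4} (complete V) B2" "decomp {4} (complete V) B3"
    and "B1 \<inter> B2 = B1 \<inter> B3" "B1 \<inter> B3 = B2 \<inter> B3" and k: "int (card (B1 \<inter> B2)) = k"
    unfolding J3_def S24_design_iff by blast
  then have "card (B1 \<inter> B2) \<in> common3 (complete V)" by (intro common3I)
  then show "k \<in> int ` (\<Union>V\<in>{V :: nat set. finite V \<and> card V = v}. common3 (complete V))"
    using V k by blast
next
  fix k assume "k \<in> int ` (\<Union>V\<in>{V :: nat set. finite V \<and> card V = v}. common3 (complete V))"
  then obtain V :: "nat set" and l where V: "finite V" "card V = v" and l: "l \<in> common3 (complete V)" "k = int l"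
    by blast
  then show "k \<in> J3 v"
    unfolding J3_def S24_design_iff common3_def by blast
qed

lemma J3_subset_I3:
  assumes "v = 12 * u + 1"
  shows "J3 v \<subseteq> I3 v"
proof
  fix k assume "k \<in> J3 v"
  then obtain V :: "nat set" and l where V: "finite V" "card V = v" and l: "l \<in> common3 (complete V)" "k = int l"
    unfolding J3_eq by blast
  have "card (complete V) = 12 * (u * v)"
    using card_complete[OF V(1)] V(2) assms by simp
  then have "l = u * v \<or> l + 8 \<le> u * v"
    using common3_gap[OF l(1) finite_complete[OF V(1)]] by blast
  moreover have "num_blocks v = int (u * v)"
    unfolding num_blocks_def by (simp add: assms algebra_simps)
  ultimately show "k \<in> I3 v"
    unfolding I3_def l(2) by (auto simp del: of_nat_mult)
qed

text \<open>Relabelling: \<open>J3\<close> asks for natural numbers as points, whereas the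
  construction produces points of a structured type.\<close>

lemma common3_complete_in_J3:
  assumes "k \<in> common3 (complete V)" "finite V" "card V = v"
  shows "int k \<in> J3 v"
proof -
  obtain f :: "'a \<Rightarrow> nat" where f: "bij_betw f V {0..<card V}"
    using ex_bij_betw_finite_nat[OF assms(2)] by blast
  then have inj: "inj_on f V" by (simp add: bij_betw_def)
  have "k \<in> common3 (complete (f ` V))"
    using common3_image[OF assms(1) inj_on_subset[OF inj Field_complete]] image_complete[OF inj] by simp
  moreover have "card (f ` V) = v" "finite (f ` V)" using card_image[OF inj] assms(2,3) by auto
  ultimately show ?thesis unfolding J3_eq by blast
qed

section \<open>Group divisible and transversal designs\<close>

lemma finite_blow: "finite E \<Longrightarrow> finite W \<Longrightarrow> finite (blow E W)"
  by (rule finite_subset[of _ "(\<lambda>((x, y), (i, j)). ((x, i), (y, j))) ` (E \<times> (W \<times> W))"])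
    (auto simp: blow_def image_iff, force)

lemma Field_blow: "Field (blow E W) \<subseteq> Field E \<times> W"
  by (auto simp: blow_def Field_def)

lemma blow_UN: "blow (\<Union>i\<in>I. E i) W = (\<Union>i\<in>I. blow (E i) W)"
  by (auto simp: blow_def)

lemma disjoint_family_blow: "disjoint_family_on E I \<Longrightarrow> disjoint_family_on (\<lambda>i. blow (E i) W) I"
  unfolding disjoint_family_on_def blow_def by blast

lemma image_blow:
  "map_prod (map_prod f g) (map_prod f g) ` blow E W = blow (map_prod f f ` E) (g ` W)"
proof
  show "blow (map_prod f f ` E) (g ` W) \<subseteq> map_prod (map_prod f g) (map_prod f g) ` blow E W"
  proof clarify
    fix x' i' y' j' assume "((x', i'), (y', j')) \<in> blow (map_prod f f ` E) (g ` W)"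
    then obtain x y i j where "(x, y) \<in> E" "i \<in> W" "j \<in> W" "x' = f x" "y' = f y" "i' = g i" "j' = g j"
      unfolding blow_def by auto
    then show "((x', i'), (y', j')) \<in> map_prod (map_prod f g) (map_prod f g) ` blow E W"
      by (intro image_eqI[of _ _ "((x, i), (y, j))"]) (auto simp: blow_def)
  qed
qed (auto simp: blow_def)

lemma inj_on_map_prod: "inj_on f A \<Longrightarrow> inj_on g B \<Longrightarrow> inj_on (map_prod f g) (A \<times> B)"
  by (auto simp: inj_on_def)

lemma inj_on_blow_complete:
  assumes "inj_on f X" "inj_on g W"
  shows "inj_on (map_prod f g) (Field (blow (complete X) W))"
  by (rule inj_on_subset[OF inj_on_map_prod[OF assms]])
    (use Field_blow[of "complete X" W] Field_complete[of X] in blast)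

lemma decomp_blow_bij:
  assumes "decomp K (blow (complete X) W) B" "bij_betw f X X'" "bij_betw g W W'"
  shows "\<exists>B'. decomp K (blow (complete X') W') B'"
proof -
  have inj: "inj_on f X" "inj_on g W" and im: "f ` X = X'" "g ` W = W'"
    using assms(2,3) by (auto simp: bij_betw_def)
  show ?thesis
    using decomp_image[OF assms(1) inj_on_blow_complete[OF inj]]
    unfolding image_blow image_complete[OF inj(1)] im by blast
qed

text \<open>\<open>gdd3 u\<close>: there is a 4-GDD of type \<open>3\<^sup>u\<close>.\<close>

definition gdd3 :: "nat \<Rightarrow> bool" where
  "gdd3 u \<longleftrightarrow> (\<exists>B. decomp {4} (blow (complete {..<u}) {..<3::nat}) B)"

section \<open>4-GDDs with groups of size 3 from pairwise balanced designs\<close>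

lemma gdd3_iff:
  assumes "finite X"
  shows "gdd3 (card X) \<longleftrightarrow> (\<exists>B. decomp {4} (blow (complete X) {..<3::nat}) B)"
proof -
  obtain f where f: "bij_betw f X {..<card X}"
    using ex_bij_betw_finite_nat[OF assms] by (auto simp: atLeast0LessThan)
  show ?thesis
    unfolding gdd3_def
    using decomp_blow_bij[OF _ f bij_betw_id] decomp_blow_bij[OF _ bij_betw_inv_into[OF f] bij_betw_id]
    by blast
qed

lemma decomp_empty: "decomp K {} {}"
  by (simp add: decomp_def)

text \<open>With at most one group there is no edge to cover. This admits empty and one-point pieces
  in the truncations.\<close>

lemma gdd3_trivial: "u \<le> 1 \<Longrightarrow> gdd3 u"
proof -
  assume "u \<le> 1"
  then have "blow (complete {..<u}) {..<3::nat} = {}" by (auto simp: blow_def complete_def)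
  then show ?thesis unfolding gdd3_def using decomp_empty by metis
qed

text \<open>Wilson's fundamental construction with weight 3: replace each block \<open>A\<close> of
  a pairwise balanced design by a 4-GDD over \<open>A\<close>. An edge between two inflated points
  lies over exactly one \<open>A\<close>, so the pieces are edge-disjoint.\<close>

lemma gdd3_pbd:
  assumes fin: "finite V"
    and sub: "\<And>A. A \<in> \<A> \<Longrightarrow> A \<subseteq> V" and gdd: "\<And>A. A \<in> \<A> \<Longrightarrow> gdd3 (card A)"
    and ex: "\<And>x y. x \<in> V \<Longrightarrow> y \<in> V \<Longrightarrow> x \<noteq> y \<Longrightarrow> \<exists>A\<in>\<A>. x \<in> A \<and> y \<in> A"
    and uniq: "\<And>A A' x y. A \<in> \<A> \<Longrightarrow> A' \<in> \<A> \<Longrightarrow> x \<in> A \<Longrightarrow> y \<in> A \<Longrightarrow> x \<in> A' \<Longrightarrow> y \<in> A' \<Longrightarrow>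
      x \<noteq> y \<Longrightarrow> A = A'"
  shows "gdd3 (card V)"
proof -
  have "\<forall>A\<in>\<A>. \<exists>B. decomp {4} (blow (complete A) {..<3::nat}) B"
    using gdd gdd3_iff[OF finite_subset[OF sub fin]] by simp
  from bchoice[OF this] obtain B where
    B: "\<And>A. A \<in> \<A> \<Longrightarrow> decomp {4} (blow (complete A) {..<3::nat}) (B A)" by blast
  have "disjoint_family_on complete \<A>"
    unfolding disjoint_family_on_def complete_def using uniq by blast
  from decomp_UN[OF B disjoint_family_blow[OF this]]
  have "decomp {4} (blow (\<Union>A\<in>\<A>. complete A) {..<3::nat}) (\<Union>A\<in>\<A>. B A)"
    by (simp add: blow_UN)
  moreover have "(\<Union>A\<in>\<A>. complete A) = complete V"
    using sub ex by (auto simp: complete_def)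
  ultimately show ?thesis using gdd3_iff[OF fin] by auto
qed

text \<open>Restricted to \<open>V\<close>, blocks and groups together form a pairwise balanced
  design: points in different groups are joined by a block, points in one group by that
  group.\<close>

lemma gdd3_truncate:
  assumes d: "decomp K (blow (complete X) W) B" and fin: "finite V" and V: "V \<subseteq> X \<times> W"
    and gB: "\<And>b. b \<in> B \<Longrightarrow> gdd3 (card (b \<inter> V))"
    and gX: "\<And>x. x \<in> X \<Longrightarrow> gdd3 (card (V \<inter> {x} \<times> W))"
  shows "gdd3 (card V)"
proof -
  have edge: "fst p \<noteq> fst q" if "b \<in> B" "p \<in> b" "q \<in> b" "p \<noteq> q" for b p q
    using decomp_iff[OF d, of p q] that by (auto simp: blow_def complete_def)
  show ?thesis
  proof (rule gdd3_pbd[OF fin, of "(\<lambda>b. b \<inter> V) ` B \<union> (\<lambda>x. V \<inter> {x} \<times> W) ` X"])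
    fix p q assume pq: "p \<in> V" "q \<in> V" "p \<noteq> q"
    show "\<exists>A\<in>(\<lambda>b. b \<inter> V) ` B \<union> (\<lambda>x. V \<inter> {x} \<times> W) ` X. p \<in> A \<and> q \<in> A"
    proof (cases "fst p = fst q")
      case True
      obtain x i j where "p = (x, i)" "q = (x, j)" using True by (metis prod.collapse)
      then have "p \<in> V \<inter> {x} \<times> W" "q \<in> V \<inter> {x} \<times> W" "x \<in> X" using pq V by auto
      then show ?thesis by (intro bexI[of _ "V \<inter> {x} \<times> W"] conjI) simp_all
    next
      case False
      then have "(p, q) \<in> blow (complete X) W"
        using pq V by (auto simp: blow_def complete_def)
      then obtain b where "b \<in> B" "p \<in> b" "q \<in> b" using decomp_iff[OF d] by blast
      then show ?thesis using pq by (intro bexI[of _ "b \<inter> V"]) simp_all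
    qed
  next
    fix A A' p q
    assume A: "A \<in> (\<lambda>b. b \<inter> V) ` B \<union> (\<lambda>x. V \<inter> {x} \<times> W) ` X"
      and A': "A' \<in> (\<lambda>b. b \<inter> V) ` B \<union> (\<lambda>x. V \<inter> {x} \<times> W) ` X"
      and pq: "p \<in> A" "q \<in> A" "p \<in> A'" "q \<in> A'" "p \<noteq> q"
    show "A = A'"
    proof (cases "fst p = fst q")
      case True
      have "C = V \<inter> {fst p} \<times> W" if "C \<in> (\<lambda>b. b \<inter> V) ` B \<union> (\<lambda>x. V \<inter> {x} \<times> W) ` X" "p \<in> C" "q \<in> C" for C
        using that(1)
      proof
        assume "C \<in> (\<lambda>b. b \<inter> V) ` B"
        then show ?thesis using that(2,3) edge[of _ p q] True pq(5) by blast
      next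
        assume "C \<in> (\<lambda>x. V \<inter> {x} \<times> W) ` X"
        then show ?thesis using that(2) by auto
      qed
      from this[OF A pq(1,2)] this[OF A' pq(3,4)] show ?thesis by simp
    next
      case False
      have "\<exists>b\<in>B. C = b \<inter> V" if "C \<in> (\<lambda>b. b \<inter> V) ` B \<union> (\<lambda>x. V \<inter> {x} \<times> W) ` X" "p \<in> C" "q \<in> C" for C
        using that(1)
      proof
        assume "C \<in> (\<lambda>x. V \<inter> {x} \<times> W) ` X"
        then obtain x where "C = V \<inter> {x} \<times> W" ..
        then have "fst p = x" "fst q = x" using that(2,3) by auto
        then show ?thesis using False by simp
      qed auto
      from this[OF A pq(1,2)] this[OF A' pq(3,4)]
      obtain b b' where b: "b \<in> B" "A = b \<inter> V" "b' \<in> B" "A' = b' \<inter> V" by blast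
      then have "b = b'" using decomp_unique[OF d b(1,3) pq(5)] pq by blast
      then show ?thesis using b by simp
    qed
  qed (use gB gX in auto)
qed

text \<open>Adjoin one new point \<open>None\<close> to every group. Extended groups meet only in
  it, so with the old blocks they form a pairwise balanced design.\<close>

lemma gdd3_fill_point:
  assumes d: "decomp K (blow (complete X) W) B" and fin: "finite X" "finite W"
    and gB: "\<And>k. k \<in> K \<Longrightarrow> gdd3 k" and gW: "gdd3 (card W + 1)"
  shows "gdd3 (card X * card W + 1)"
proof -
  define V where "V = insert None (Some ` (X \<times> W))"
  define group where "group x = insert None (Some ` ({x} \<times> W))" for x :: 'a
  have card_ins: "card (insert None (Some ` P)) = card P + 1" if "finite P" for P :: "('a \<times> 'b) set"
    using that by (simp add: card_image)
  have edge: "fst p \<noteq> fst q" if "b \<in> B" "p \<in> b" "q \<in> b" "p \<noteq> q" for b p q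
    using decomp_iff[OF d, of p q] that by (auto simp: blow_def complete_def)
  have bsub: "b \<subseteq> X \<times> W" if "b \<in> B" for b
    using decomp_Field[OF d] Field_blow[of "complete X" W] Field_complete[of X] that by blast
  have "gdd3 (card V)"
  proof (rule gdd3_pbd[of V "(`) Some ` B \<union> group ` X"])
    show "finite V" using fin by (simp add: V_def)
  next
    fix A assume A: "A \<in> (`) Some ` B \<union> group ` X"
    then show "A \<subseteq> V" using bsub by (fastforce simp: V_def group_def)
    from A show "gdd3 (card A)"
    proof
      assume "A \<in> (`) Some ` B"
      then obtain b where "b \<in> B" "A = Some ` b" by blast
      then show ?thesis using gB[OF decomp_card[OF d]] by (simp add: card_image)
    next
      assume "A \<in> group ` X"
      then obtain x where "A = group x" by blast
      then have "card A = card W + 1" unfolding group_def using card_ins[of "{x} \<times> W"] fin(2) by (metis card_cartesian_product_singleton finite.emptyI finite.insertI finite_cartesian_product)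
      then show ?thesis using gW by metis
    qed
  next
    fix p q assume pq: "p \<in> V" "q \<in> V" "p \<noteq> q"
    consider x i j where "p = None \<or> p = Some (x, i)" "q = None \<or> q = Some (x, j)" "x \<in> X" "i \<in> W" "j \<in> W"
      | x i y j where "p = Some (x, i)" "q = Some (y, j)" "x \<in> X" "y \<in> X" "i \<in> W" "j \<in> W"
    proof (cases p)
      case None
      then obtain x i where "q = Some (x, i)" "x \<in> X" "i \<in> W" using pq by (auto simp: V_def)
      then show thesis using that(1)[of x i i] None by blast
    next
      case (Some p')
      then obtain x i where p: "p = Some (x, i)" "x \<in> X" "i \<in> W" using pq by (auto simp: V_def)
      show thesis
      proof (cases q)
        case None
        then show thesis using that(1)[of x i i] p by blast
      next
        case (Some q')
        then obtain y j where "q = Some (y, j)" "y \<in> X" "j \<in> W" using pq by (auto simp: V_def)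
        then show thesis using that(2)[of x i y j] p by blast
      qed
    qed
    then show "\<exists>A\<in>(`) Some ` B \<union> group ` X. p \<in> A \<and> q \<in> A"
    proof cases
      case 1
      then have "p \<in> group x" "q \<in> group x" by (auto simp: group_def)
      then show ?thesis using 1(3) by (intro bexI[of _ "group x"]) simp_all
    next
      case 2
      show ?thesis
      proof (cases "x = y")
        case True
        then have "p \<in> group x" "q \<in> group x" using 2 by (auto simp: group_def)
        then show ?thesis using 2(3) by (intro bexI[of _ "group x"]) simp_all
      next
        case False
        then have "((x, i), (y, j)) \<in> blow (complete X) W"
          using 2 by (auto simp: blow_def complete_def)
        then obtain b where "b \<in> B" "(x, i) \<in> b" "(y, j) \<in> b" using decomp_iff[OF d] by blast
        then show ?thesis using 2(1,2) by (intro bexI[of _ "Some ` b"]) simp_all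
      qed
    qed
  next
    fix A A' p q
    assume A: "A \<in> (`) Some ` B \<union> group ` X" and A': "A' \<in> (`) Some ` B \<union> group ` X"
      and pq: "p \<in> A" "q \<in> A" "p \<in> A'" "q \<in> A'" "p \<noteq> q"
    have gg: "x = y" if "p \<in> group x" "q \<in> group x" "p \<in> group y" "q \<in> group y" for x y
      using that pq(5) by (auto simp: group_def)
    have gb: False if g: "p \<in> group x" "q \<in> group x" "b \<in> B" "p \<in> Some ` b" "q \<in> Some ` b" for x b
    proof -
      obtain p' q' where p': "p = Some p'" "q = Some q'" "p' \<in> b" "q' \<in> b" using g(4,5) by blast
      then have "fst p' = fst q'" using g by (auto simp: group_def)
      then show False using edge[OF g(3) p'(3,4)] p' pq(5) by blast
    qed
    have bb: "b = c" if bc: "b \<in> B" "c \<in> B" and m: "p \<in> Some ` b" "q \<in> Some ` b" "p \<in> Some ` c" "q \<in> Some ` c" for b c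
    proof -
      obtain p' q' where "p = Some p'" "q = Some q'" "p' \<in> b" "q' \<in> b" "p' \<in> c" "q' \<in> c"
        using m by blast
      then show ?thesis using decomp_unique[OF d bc, of p' q'] pq(5) by blast
    qed
    show "A = A'"
    proof (cases "A \<in> group ` X")
      case True
      then obtain x where x: "A = group x" by blast
      have "A' \<in> group ` X" using A' gb[of x] pq x by blast
      then obtain y where "A' = group y" by blast
      then show ?thesis using gg[of x y] pq x by simp
    next
      case False
      then obtain b where b: "A = Some ` b" "b \<in> B" using A by blast
      have "A' \<notin> group ` X" using gb[OF _ _ b(2)] pq b(1) by blast
      then obtain c where "A' = Some ` c" "c \<in> B" using A' by blast
      then show ?thesis using bb[of b c] pq b by simp
    qed
  qed
  then show ?thesis unfolding V_def using card_ins[of "X \<times> W"] fin by (metis card_cartesian_product finite_cartesian_product)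
qed

text \<open>Transversal designs and, below, orthogonal arrays.\<close>

definition td :: "nat \<Rightarrow> nat \<Rightarrow> bool" where
  "td k n \<longleftrightarrow> (\<exists>B. decomp {k} (blow (complete {..<k}) {..<n}) B)"

lemma gdd3_td:
  assumes "td k n" "gdd3 k" "gdd3 n"
  shows "gdd3 (k * n)"
proof -
  obtain B where B: "decomp {k} (blow (complete {..<k}) {..<n}) B"
    using assms(1) unfolding td_def by blast
  have "b \<subseteq> {..<k} \<times> {..<n}" if "b \<in> B" for b
    using decomp_Field[OF B] Field_blow[of "complete {..<k}" "{..<n}"] Field_complete[of "{..<k}"] that by blast
  then have "card (b \<inter> {..<k} \<times> {..<n}) = k" if "b \<in> B" for b
    using decomp_card[OF B that] that by (simp add: Int_absorb2)
  moreover have "card ({..<k} \<times> {..<n} \<inter> {x} \<times> {..<n}) = n" if "x \<in> {..<k}" for x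
  proof -
    have "{..<k} \<times> {..<n} \<inter> {x} \<times> {..<n} = {x} \<times> {..<n}" using that by auto
    then show ?thesis by simp
  qed
  ultimately have "gdd3 (card ({..<k} \<times> {..<n}))"
    using gdd3_truncate[OF B, of "{..<k} \<times> {..<n}"] assms(2,3) by simp
  then show ?thesis by simp
qed

lemma gdd3_td_point:
  assumes "td k n" "gdd3 k" "gdd3 (n + 1)"
  shows "gdd3 (k * n + 1)"
  using assms gdd3_fill_point[of "{k}" "{..<k}" "{..<n}"] unfolding td_def by auto

text \<open>A block has at most one point in the shortened group, so it keeps \<open>k\<close> or
  \<open>Suc k\<close> points.\<close>

lemma gdd3_td_truncate:
  assumes "td (Suc k) n" "h \<le> n" "gdd3 k" "gdd3 (Suc k)" "gdd3 n" "gdd3 h"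
  shows "gdd3 (k * n + h)"
proof -
  obtain B where B: "decomp {Suc k} (blow (complete {..<Suc k}) {..<n}) B"
    using assms(1) unfolding td_def by blast
  define V where "V = {..<k} \<times> {..<n} \<union> {k} \<times> {..<h}"
  have cV: "card V = k * n + h"
    unfolding V_def by (subst card_Un_disjoint) auto
  have "gdd3 (card V)"
  proof (rule gdd3_truncate[OF B])
    show "finite V" by (simp add: V_def)
    show "V \<subseteq> {..<Suc k} \<times> {..<n}" using assms(2) by (auto simp: V_def)
  next
    fix b assume b: "b \<in> B"
    have cb: "card b = Suc k" using decomp_card[OF B b] by simp
    then have fb: "finite b" using card.infinite by fastforce
    have bsub: "b \<subseteq> {..<Suc k} \<times> {..<n}"
      using decomp_Field[OF B] Field_blow[of "complete {..<Suc k}" "{..<n}"] Field_complete[of "{..<Suc k}"] b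
      by blast
    have "p = q" if "p \<in> b - V" "q \<in> b - V" for p q
    proof -
      have "fst p = k" "fst q = k" using that bsub by (auto simp: V_def less_Suc_eq)
      then show ?thesis
        using decomp_iff[OF B, of p q] b that by (auto simp: blow_def complete_def)
    qed
    then have "card (b - V) \<le> 1" using card_le_Suc0_iff_eq[of "b - V"] fb by auto
    moreover have "card (b - V) + card (b \<inter> V) = Suc k"
      using card_Diff_subset_Int[of b V] card_mono[of b "b \<inter> V"] fb cb by simp
    ultimately have "card (b \<inter> V) = k \<or> card (b \<inter> V) = Suc k" by linarith
    then show "gdd3 (card (b \<inter> V))" using assms(3,4) by auto
  next
    fix x assume x: "x \<in> {..<Suc k}"
    show "gdd3 (card (V \<inter> {x} \<times> {..<n}))"
    proof (cases "x = k")
      case True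
      then have "V \<inter> {x} \<times> {..<n} = {k} \<times> {..<h}" using assms(2) by (auto simp: V_def)
      then show ?thesis using assms(6) by simp
    next
      case False
      then have "V \<inter> {x} \<times> {..<n} = {x} \<times> {..<n}" using x by (auto simp: V_def)
      then show ?thesis using assms(5) by simp
    qed
  qed
  then show ?thesis by (simp add: cV)
qed

text \<open>The 4-GDD serves as input once more: one new point extends its groups from 3 to 4
  points, so all blocks on the \<open>3 * u + 1\<close> points have size 4.\<close>

lemma gdd3_triple: "gdd3 u \<Longrightarrow> gdd3 4 \<Longrightarrow> gdd3 (3 * u + 1)"
  using gdd3_fill_point[of "{4}" "{..<u}" "{..<3::nat}"] unfolding gdd3_def[of u]
  by (auto simp: mult.commute)

section \<open>Orthogonal arrays with columns indexed by pairs\<close>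

definition oa :: "nat \<Rightarrow> 'a set \<Rightarrow> (nat \<Rightarrow> 'a \<Rightarrow> 'a \<Rightarrow> 'a) \<Rightarrow> bool" where
  "oa k S f \<longleftrightarrow> (\<forall>i<k. \<forall>a\<in>S. \<forall>b\<in>S. f i a b \<in> S) \<and>
     (\<forall>j<k. \<forall>i<j. inj_on (\<lambda>(a, b). (f i a b, f j a b)) (S \<times> S))"

lemma oa_inj:
  assumes "oa k S f" "i < k" "j < k" "i \<noteq> j"
  shows "inj_on (\<lambda>(a, b). (f i a b, f j a b)) (S \<times> S)"
proof -
  consider "i < j" | "j < i" using assms(4) by linarith
  then show ?thesis
  proof cases
    case 1 then show ?thesis using assms unfolding oa_def by blast
  next
    case 2
    then have "inj_on (\<lambda>(a, b). (f j a b, f i a b)) (S \<times> S)" using assms unfolding oa_def by blast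
    then show ?thesis by (auto simp: inj_on_def)
  qed
qed

text \<open>Column \<open>(a, b)\<close> becomes the block of all points
  \<open>(i, f i a b)\<close>. Two rows determine the column, so two points in different groups lie
  on exactly one block.\<close>

lemma oa_td:
  assumes oa: "oa k S f" and fin: "finite S" and k: "2 \<le> k"
  shows "td k (card S)"
proof -
  define blk where "blk = (\<lambda>(a, b). (\<lambda>i. (i, f i a b)) ` {..<k})"
  have fS: "f i a b \<in> S" if "i < k" "a \<in> S" "b \<in> S" for i a b
    using oa that unfolding oa_def by blast
  have "decomp {k} (blow (complete {..<k}) S) (blk ` (S \<times> S))"
    unfolding decomp_def
  proof (intro conjI ballI allI impI)
    fix c assume "c \<in> blk ` (S \<times> S)"
    then have "card c = k" by (auto simp: blk_def card_image inj_on_def)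
    then show "card c \<in> {k}" "2 \<le> card c" using k by simp_all
  next
    fix c d p q assume "c \<in> blk ` (S \<times> S)" "d \<in> blk ` (S \<times> S)" "p \<noteq> q \<and> p \<in> c \<and> q \<in> c \<and> p \<in> d \<and> q \<in> d"
    moreover from this obtain a b a' b' where cd: "c = blk (a, b)" "d = blk (a', b')"
      "a \<in> S" "b \<in> S" "a' \<in> S" "b' \<in> S" by blast
    ultimately obtain i j where *: "i < k" "j < k" "i \<noteq> j" "f i a b = f i a' b'" "f j a b = f j a' b'"
      unfolding blk_def by auto
    then have "(a, b) = (a', b')"
      using inj_onD[OF oa_inj[OF oa *(1-3)], of "(a, b)" "(a', b')"] cd by auto
    then show "c = d" using cd by simp
  next
    fix p q
    show "(p, q) \<in> blow (complete {..<k}) S \<longleftrightarrow> p \<noteq> q \<and> (\<exists>c\<in>blk ` (S \<times> S). p \<in> c \<and> q \<in> c)"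
    proof
      assume "(p, q) \<in> blow (complete {..<k}) S"
      then obtain i s j t where pq: "p = (i, s)" "q = (j, t)" "i < k" "j < k" "i \<noteq> j" "s \<in> S" "t \<in> S"
        by (auto simp: blow_def complete_def)
      let ?g = "\<lambda>(a, b). (f i a b, f j a b)"
      \<comment> \<open>Injectivity gives uniqueness of the block; for finite \<open>S\<close> it
        also gives surjectivity, hence existence.\<close>
      have "?g ` (S \<times> S) = S \<times> S"
        by (rule endo_inj_surj[OF _ _ oa_inj[OF oa pq(3-5)]]) (use fin fS pq in auto)
      then have "(s, t) \<in> ?g ` (S \<times> S)" using pq by blast
      then obtain a b where "a \<in> S" "b \<in> S" "s = f i a b" "t = f j a b" by auto
      then show "p \<noteq> q \<and> (\<exists>c\<in>blk ` (S \<times> S). p \<in> c \<and> q \<in> c)"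
        using pq by (intro conjI bexI[of _ "blk (a, b)"]) (auto simp: blk_def)
    next
      assume "p \<noteq> q \<and> (\<exists>c\<in>blk ` (S \<times> S). p \<in> c \<and> q \<in> c)"
      then show "(p, q) \<in> blow (complete {..<k}) S"
        using fS by (auto simp: blk_def blow_def complete_def)
    qed
  qed
  moreover obtain g where "bij_betw g S {..<card S}"
    using ex_bij_betw_finite_nat[OF fin] by (auto simp: atLeast0LessThan)
  ultimately show ?thesis
    unfolding td_def using decomp_blow_bij[OF _ bij_betw_id] by blast
qed

lemma oa_mono: "oa k S f \<Longrightarrow> l \<le> k \<Longrightarrow> oa l S f"
  unfolding oa_def by auto

text \<open>MacNeish's product: both factors are recovered coordinatewise from any two rows.\<close>

lemma oa_prod:
  assumes "oa k S f" "oa k S' f'"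
  shows "oa k (S \<times> S') (\<lambda>i p q. (f i (fst p) (fst q), f' i (snd p) (snd q)))"
  unfolding oa_def
proof (intro conjI allI impI ballI)
  fix i j assume ij: "j < k" "i < j"
  have 1: "inj_on (\<lambda>(a, b). (f i a b, f j a b)) (S \<times> S)" "inj_on (\<lambda>(a, b). (f' i a b, f' j a b)) (S' \<times> S')"
    using assms ij unfolding oa_def by blast+
  show "inj_on (\<lambda>(p, q). ((f i (fst p) (fst q), f' i (snd p) (snd q)),
      (f j (fst p) (fst q), f' j (snd p) (snd q)))) ((S \<times> S') \<times> (S \<times> S'))"
  proof (rule inj_onI)
    fix P Q assume PQ: "P \<in> (S \<times> S') \<times> (S \<times> S')" "Q \<in> (S \<times> S') \<times> (S \<times> S')"
      "(\<lambda>(p, q). ((f i (fst p) (fst q), f' i (snd p) (snd q)), (f j (fst p) (fst q), f' j (snd p) (snd q)))) P =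
       (\<lambda>(p, q). ((f i (fst p) (fst q), f' i (snd p) (snd q)), (f j (fst p) (fst q), f' j (snd p) (snd q)))) Q"
    obtain a a' b b' where P: "P = ((a, a'), (b, b'))" by (metis surj_pair)
    obtain c c' d d' where Q: "Q = ((c, c'), (d, d'))" by (metis surj_pair)
    have "(a, b) = (c, d)" by (rule inj_onD[OF 1(1)]) (use PQ P Q in auto)
    moreover have "(a', b') = (c', d')" by (rule inj_onD[OF 1(2)]) (use PQ P Q in auto)
    ultimately show "P = Q" by (simp add: P Q)
  qed
qed (use assms in \<open>auto simp: oa_def\<close>)

text \<open>The parallel classes of lines over the integers mod \<open>n\<close>: row 0 is the
  vertical class, row \<open>i > 0\<close> has slope \<open>i - 1\<close>.\<close>

definition cyclic_oa :: "nat \<Rightarrow> nat \<Rightarrow> nat \<Rightarrow> nat \<Rightarrow> nat" where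
  "cyclic_oa n i a b = (if i = 0 then b else (a + (i - 1) * b) mod n)"

text \<open>Two sloped rows determine their difference, a multiple \<open>d * b\<close>, and so
  \<open>b\<close> as soon as \<open>d\<close> is a unit mod \<open>n\<close>. Slopes run from 0 to
  \<open>k - 2\<close>, so \<open>d\<close> runs from 1 to \<open>k - 2\<close>.\<close>

lemma oa_cyclic:
  assumes cop: "\<And>d. 0 < d \<Longrightarrow> d + 1 < k \<Longrightarrow> coprime d n" and n: "0 < n"
  shows "oa k {..<n} (cyclic_oa n)"
proof -
  have eqI: "x = y" if "x < n" "y < n" "int n dvd int x - int y" for x y
  proof -
    have "[int x = int y] (mod int n)" using that(3) by (simp add: cong_iff_dvd_diff)
    then have "[x = y] (mod n)" by (simp add: cong_int_iff)
    then show ?thesis using that by (simp add: cong_def)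
  qed
  have dvdI: "int n dvd (int a + int m * int b) - (int a' + int m * int b')"
    if "(a + m * b) mod n = (a' + m * b') mod n" for a a' b b' m
  proof -
    have "[int (a + m * b) = int (a' + m * b')] (mod int n)"
      unfolding cong_int_iff using that by (simp only: cong_def)
    then show ?thesis by (simp add: cong_iff_dvd_diff)
  qed
  have "inj_on (\<lambda>(a, b). (cyclic_oa n i a b, cyclic_oa n j a b)) ({..<n} \<times> {..<n})" if ij: "j < k" "i < j" for i j
  proof (rule inj_onI, clarsimp)
    fix a b a' b' assume lt: "a < n" "b < n" "a' < n" "b' < n"
      and eq: "cyclic_oa n i a b = cyclic_oa n i a' b'" "cyclic_oa n j a b = cyclic_oa n j a' b'"
    have j: "int n dvd (int a + int (j - 1) * int b) - (int a' + int (j - 1) * int b')"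
      using dvdI[of a "j - 1" b a' b'] eq(2) ij by (simp add: cyclic_oa_def)
    have b: "b = b'"
    proof (cases "i = 0")
      case True
      then show ?thesis using eq(1) by (simp add: cyclic_oa_def)
    next
      case False
      have i: "int n dvd (int a + int (i - 1) * int b) - (int a' + int (i - 1) * int b')"
        using dvdI[of a "i - 1" b a' b'] eq(1) False by (simp add: cyclic_oa_def)
      have "int (j - 1) = int (i - 1) + int (j - i)" using ij False by simp
      then have "int n dvd int (j - i) * (int b - int b')"
        using dvd_diff[OF j i] by (simp add: algebra_simps)
      moreover have "coprime (int n) (int (j - i))"
        unfolding coprime_int_iff using cop[of "j - i"] ij False by (simp add: coprime_commute)
      ultimately have "int n dvd int b - int b'"
        using coprime_dvd_mult_right_iff by blast
      then show ?thesis using eqI lt by blast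
    qed
    then show "a = a' \<and> b = b'" using j eqI lt by simp
  qed
  then show ?thesis using n unfolding oa_def by (auto simp: cyclic_oa_def)
qed

section \<open>Checking explicit designs\<close>

text \<open>Merge sort as an unverified normaliser: only preservation of the multiset is proved.
  Sortedness is never proved, because the outcome is compared with a strictly increasing
  list.\<close>

fun merge :: "nat list \<Rightarrow> nat list \<Rightarrow> nat list" where
  "merge [] ys = ys"
| "merge xs [] = xs"
| "merge (x # xs) (y # ys) = (if x \<le> y then x # merge xs (y # ys) else y # merge (x # xs) ys)"

fun merge_adjacent :: "nat list list \<Rightarrow> nat list list" where
  "merge_adjacent (xs # ys # xss) = merge xs ys # merge_adjacent xss"
| "merge_adjacent xss = xss"

fun merge_rounds :: "nat \<Rightarrow> nat list list \<Rightarrow> nat list" where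
  "merge_rounds 0 xss = concat xss"
| "merge_rounds (Suc k) xss = merge_rounds k (merge_adjacent xss)"

lemma mset_merge: "mset (merge xs ys) = mset xs + mset ys"
  by (induction xs ys rule: merge.induct) auto

lemma mset_merge_adjacent: "mset (concat (merge_adjacent xss)) = mset (concat xss)"
  by (induction xss rule: merge_adjacent.induct) (auto simp: mset_merge)

lemma mset_merge_rounds: "mset (merge_rounds k xss) = mset (concat xss)"
proof (induction k arbitrary: xss)
  case (Suc k)
  then show ?case using mset_merge_adjacent[of xss] by (simp only: merge_rounds.simps)
qed simp

lemma merge_rounds_eqD:
  assumes "merge_rounds k xss = zs" "sorted_wrt (<) zs"
  shows "distinct (concat xss)" "set (concat xss) = set zs"
proof -
  have m: "mset (concat xss) = mset zs" using assms(1) mset_merge_rounds by metis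
  show "set (concat xss) = set zs" by (rule mset_eq_setD[OF m])
  show "distinct (concat xss)"
    using mset_eq_imp_distinct_iff[OF m] assms(2) strict_sorted_iff by blast
qed

fun pair_codes :: "nat \<Rightarrow> nat list \<Rightarrow> nat list" where
  "pair_codes n [] = []"
| "pair_codes n (x # xs) = map (\<lambda>y. n * x + y) xs @ pair_codes n xs"

text \<open>The expected edges of a complete multipartite graph whose groups are intervals of length
  \<open>g\<close>, each edge coded by one number. They are generated already in increasing
  order.\<close>

definition cross_codes :: "nat \<Rightarrow> nat \<Rightarrow> nat list" where
  "cross_codes g n = concat (map (\<lambda>x. map (\<lambda>y. n * x + y)
     (filter (\<lambda>y. x < y \<and> x div g \<noteq> y div g) [0..<n])) [0..<n])"

text \<open>Seven rounds of merging suffice for the at most 128 lists that occur below.\<close>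

definition check_blocks :: "nat \<Rightarrow> nat \<Rightarrow> nat \<Rightarrow> nat list list \<Rightarrow> bool" where
  "check_blocks k g n L \<longleftrightarrow>
     list_all (\<lambda>l. length l = k \<and> sorted_wrt (<) l \<and> list_all (\<lambda>x. x < n) l) L \<and>
     merge_rounds 7 (map (pair_codes n) L) = cross_codes g n \<and>
     successively (<) (cross_codes g n)"

lemma set_pair_codes:
  "sorted_wrt (<) l \<Longrightarrow> set (pair_codes n l) = {n * x + y | x y. x \<in> set l \<and> y \<in> set l \<and> x < y}"
  by (induction l) (auto, force+)

lemma code_eq_iff:
  assumes "y < n" "y' < (n::nat)"
  shows "n * x + y = n * x' + y' \<longleftrightarrow> x = x' \<and> y = y'"
proof
  assume *: "n * x + y = n * x' + y'"
  then have "(n * x + y) div n = (n * x' + y') div n" by simp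
  then have "x = x'" using assms by simp
  then show "x = x' \<and> y = y'" using * by simp
qed simp

lemma code_mem_iff:
  assumes "y < (n::nat)" "\<And>a b. Q a b \<Longrightarrow> b < n"
  shows "n * x + y \<in> {n * a + b | a b. Q a b} \<longleftrightarrow> Q x y"
proof
  assume "n * x + y \<in> {n * a + b | a b. Q a b}"
  then obtain a b where ab: "n * x + y = n * a + b" "Q a b" by blast
  then show "Q x y" using code_eq_iff[OF assms(1) assms(2)[OF ab(2)]] by simp
qed blast

lemma set_cross_codes:
  "set (cross_codes g n) = {n * x + y | x y. x < y \<and> y < n \<and> x div g \<noteq> y div g}"
  unfolding cross_codes_def by force

lemma distinct_concat_mapD:
  "distinct (concat (map f xs)) \<Longrightarrow> a \<in> set xs \<Longrightarrow> b \<in> set xs \<Longrightarrow> z \<in> set (f a) \<Longrightarrow> z \<in> set (f b) \<Longrightarrow> a = b"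
  by (induction xs) auto

text \<open>Distinct codes across all blocks mean that no pair is covered twice; the right set of
  codes means that exactly the pairs between different groups are covered.\<close>

lemma check_blocks_decomp:
  assumes c: "check_blocks k g n L" and k: "2 \<le> k"
  shows "decomp {k} {(x, y). x < n \<and> y < n \<and> x div g \<noteq> y div g} (set ` set L)"
proof -
  have l: "length l = k" "sorted_wrt (<) l" "\<And>x. x \<in> set l \<Longrightarrow> x < n" if "l \<in> set L" for l
    using c that unfolding check_blocks_def list_all_iff by auto
  \<comment> \<open>The check compares neighbours only, which takes linear time; transitivity
    extends it to all positions.\<close>
  have "sorted_wrt (<) (cross_codes g n)"
    using c successively_conv_sorted_wrt[of "(<) :: nat \<Rightarrow> nat \<Rightarrow> bool"] unfolding check_blocks_def by auto
  then have dist: "distinct (concat (map (pair_codes n) L))"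
    and codes: "set (concat (map (pair_codes n) L)) = set (cross_codes g n)"
    using c merge_rounds_eqD unfolding check_blocks_def by blast+
  have edge: "(x div g \<noteq> y div g) \<longleftrightarrow> (\<exists>l\<in>set L. x \<in> set l \<and> y \<in> set l)" if "x < y" "y < n" for x y
  proof -
    have "(x div g \<noteq> y div g) \<longleftrightarrow> n * x + y \<in> set (cross_codes g n)"
      unfolding set_cross_codes using that by (subst code_mem_iff) auto
    also have "\<dots> \<longleftrightarrow> (\<exists>l\<in>set L. n * x + y \<in> set (pair_codes n l))"
      unfolding codes[symmetric] by simp
    also have "\<dots> \<longleftrightarrow> (\<exists>l\<in>set L. x \<in> set l \<and> y \<in> set l)"
    proof (rule bex_cong[OF refl])
      fix l assume m: "l \<in> set L"
      show "n * x + y \<in> set (pair_codes n l) \<longleftrightarrow> x \<in> set l \<and> y \<in> set l"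
        unfolding set_pair_codes[OF l(2)[OF m]] using that l(3)[OF m] by (subst code_mem_iff) auto
    qed
    finally show ?thesis .
  qed
  have uniq: "l = l'" if "l \<in> set L" "l' \<in> set L" "x < y" "x \<in> set l" "y \<in> set l" "x \<in> set l'" "y \<in> set l'"
    for l l' x y
  proof -
    have "n * x + y \<in> set (pair_codes n l)" "n * x + y \<in> set (pair_codes n l')"
      using that l(2) set_pair_codes by blast+
    then show ?thesis using distinct_concat_mapD[OF dist that(1,2)] by blast
  qed
  show ?thesis
    unfolding decomp_def
  proof (intro conjI ballI allI impI)
    fix b assume "b \<in> set ` set L"
    then obtain m where m: "m \<in> set L" "b = set m" by blast
    have "distinct m" using l(2)[OF m(1)] strict_sorted_iff by blast
    then have "card b = k" using l(1)[OF m(1)] m(2) distinct_card by blast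
    then show "card b \<in> {k}" "2 \<le> card b" using k by auto
  next
    fix x y :: nat
    show "(x, y) \<in> {(x, y). x < n \<and> y < n \<and> x div g \<noteq> y div g} \<longleftrightarrow>
      x \<noteq> y \<and> (\<exists>b\<in>set ` set L. x \<in> b \<and> y \<in> b)"
    proof (cases x y rule: linorder_cases)
      case less
      then show ?thesis using edge[OF less] l(3) by auto
    next
      case greater
      then show ?thesis using edge[OF greater] l(3) by auto
    qed simp
  next
    fix b c x y assume b: "b \<in> set ` set L" "c \<in> set ` set L"
      and xy: "x \<noteq> y \<and> x \<in> b \<and> y \<in> b \<and> x \<in> c \<and> y \<in> c"
    obtain l l' where ll: "l \<in> set L" "b = set l" "l' \<in> set L" "c = set l'" using b by blast
    have "l = l'"
      using xy uniq[OF ll(1,3), of x y] uniq[OF ll(1,3), of y x] ll(2,4) by (cases x y rule: linorder_cases) auto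
    then show "b = c" using ll by simp
  qed
qed

text \<open>Both sides of each equation filter the same list, so equality of lists decides equality
  of the sets of common blocks. Blocks are strictly increasing lists, so they agree as lists iff
  they agree as sets.\<close>

definition check_common3 :: "nat \<Rightarrow> nat \<Rightarrow> nat \<Rightarrow> nat list list \<Rightarrow> nat list list \<Rightarrow> nat list list \<Rightarrow> bool" where
  "check_common3 g n k L1 L2 L3 \<longleftrightarrow>
     check_blocks 4 g n L1 \<and> check_blocks 4 g n L2 \<and> check_blocks 4 g n L3 \<and>
     filter (\<lambda>l. l \<in> set L2) L1 = filter (\<lambda>l. l \<in> set L3) L1 \<and>
     filter (\<lambda>l. l \<in> set L1) L3 = filter (\<lambda>l. l \<in> set L2) L3 \<and>
     length (remdups (filter (\<lambda>l. l \<in> set L2) L1)) = k"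

lemma common3_of_check:
  assumes "check_common3 g n k L1 L2 L3"
  shows "k \<in> common3 {(x, y). x < n \<and> y < n \<and> x div g \<noteq> y div g}"
proof -
  have c: "check_blocks 4 g n L1" "check_blocks 4 g n L2" "check_blocks 4 g n L3"
    and f: "filter (\<lambda>l. l \<in> set L2) L1 = filter (\<lambda>l. l \<in> set L3) L1"
      "filter (\<lambda>l. l \<in> set L1) L3 = filter (\<lambda>l. l \<in> set L2) L3"
    and k: "length (remdups (filter (\<lambda>l. l \<in> set L2) L1)) = k"
    using assms unfolding check_common3_def by auto
  have inj: "inj_on set (set L1 \<union> set L2 \<union> set L3)"
  proof (rule inj_onI)
    fix l m assume "l \<in> set L1 \<union> set L2 \<union> set L3" "m \<in> set L1 \<union> set L2 \<union> set L3" "set l = set m"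
    moreover from this have "sorted_wrt (<) l" "sorted_wrt (<) m"
      using c unfolding check_blocks_def list_all_iff by auto
    ultimately show "l = m" using strict_sorted_equal by blast
  qed
  have I: "set ` set L1 \<inter> set ` set L2 = set ` (set L1 \<inter> set L2)"
    "set ` set L1 \<inter> set ` set L3 = set ` (set L1 \<inter> set L3)"
    "set ` set L2 \<inter> set ` set L3 = set ` (set L2 \<inter> set L3)"
    by (intro inj_on_image_Int[OF inj, symmetric]; blast)+
  have "set (filter (\<lambda>l. l \<in> set L2) L1) = set (filter (\<lambda>l. l \<in> set L3) L1)"
    "set (filter (\<lambda>l. l \<in> set L1) L3) = set (filter (\<lambda>l. l \<in> set L2) L3)"
    using f by simp_all
  then have e: "set L1 \<inter> set L2 = set L1 \<inter> set L3" "set L1 \<inter> set L3 = set L2 \<inter> set L3"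
    by auto
  have "card (set ` (set L1 \<inter> set L2)) = card (set L1 \<inter> set L2)"
    by (rule card_image[OF inj_on_subset[OF inj]]) blast
  also have "\<dots> = card (set (filter (\<lambda>l. l \<in> set L2) L1))"
    by (rule arg_cong[of _ _ card]) auto
  also have "\<dots> = k" using k by (simp only: length_remdups_card_conv)
  finally have "card (set ` set L1 \<inter> set ` set L2) = k" by (simp only: I(1))
  moreover have "card (set ` set L1 \<inter> set ` set L2) \<in> common3 {(x, y). x < n \<and> y < n \<and> x div g \<noteq> y div g}"
    by (rule common3I[OF c[THEN check_blocks_decomp]]) (use I e in auto)
  ultimately show ?thesis by simp
qed

text \<open>Translates the flat numbering of the explicit designs into pairs of group and
  position.\<close>

lemma div_mod_image:
  "map_prod (\<lambda>x::nat. (x div g, x mod g)) (\<lambda>x. (x div g, x mod g)) `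
     {(x, y). x < g * u \<and> y < g * u \<and> x div g \<noteq> y div g} = blow (complete {..<u}) {..<g}"
  (is "?F ` ?E = _")
proof
  have div: "x div g < u" "x mod g < g" if "x < g * u" for x :: nat
  proof -
    show "x div g < u" using less_mult_imp_div_less[of x u g] that by (simp add: mult.commute)
    show "x mod g < g" using that by (cases g) simp_all
  qed
  then show "?F ` ?E \<subseteq> blow (complete {..<u}) {..<g}"
    by (auto simp: blow_def complete_def)
  show "blow (complete {..<u}) {..<g} \<subseteq> ?F ` ?E"
  proof clarify
    fix a i b j assume "((a, i), (b, j)) \<in> blow (complete {..<u}) {..<g}"
    then have *: "a < u" "b < u" "a \<noteq> b" "i < g" "j < g" by (auto simp: blow_def complete_def)
    have "g * a + i < g * u" if "a < u" "i < g" for a i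
    proof -
      have "g * a + i < g * Suc a" using that by simp
      also have "\<dots> \<le> g * u" using that by (intro mult_le_mono2) simp
      finally show ?thesis .
    qed
    then show "((a, i), (b, j)) \<in> ?F ` ?E"
      using * by (intro image_eqI[of _ _ "(g * a + i, g * b + j)"]) auto
  qed
qed

lemma inj_div_mod: "inj_on (\<lambda>x. (x div g, x mod g)) (A :: nat set)"
proof (rule inj_onI)
  fix x y :: nat assume "(x div g, x mod g) = (y div g, y mod g)"
  then have "x div g * g + x mod g = y div g * g + y mod g" by simp
  then show "x = y" by (simp only: div_mult_mod_eq)
qed

lemma gdd3_of_check:
  assumes "check_blocks 4 3 (3 * u) L"
  shows "gdd3 u"
  using decomp_image[OF check_blocks_decomp[OF assms] inj_div_mod, of 3]
  unfolding div_mod_image gdd3_def by auto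

text \<open>The analogue of \<open>cyclic_oa\<close> over a finite field: \<open>A\<close> is the
  addition table, and each row of \<open>M\<close> lists the multiples of the elements by one
  slope.\<close>

definition table_oa :: "nat list list \<Rightarrow> nat list list \<Rightarrow> nat \<Rightarrow> nat \<Rightarrow> nat \<Rightarrow> nat" where
  "table_oa A M i a b = (if i = 0 then b else A ! a ! (M ! (i - 1) ! b))"

text \<open>Injectivity of a pair of rows is tested by requiring the codes of its
  \<open>n * n\<close> columns to be a permutation of \<open>[0..<n * n]\<close>.\<close>

definition check_oa :: "nat \<Rightarrow> nat \<Rightarrow> (nat \<Rightarrow> nat \<Rightarrow> nat \<Rightarrow> nat) \<Rightarrow> bool" where
  "check_oa k n f \<longleftrightarrow>
     list_all (\<lambda>i. list_all (\<lambda>a. list_all (\<lambda>b. f i a b < n) [0..<n]) [0..<n]) [0..<k] \<and>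
     list_all (\<lambda>j. list_all (\<lambda>i. merge_rounds 7
       (map (\<lambda>(a, b). [n * f i a b + f j a b]) (List.product [0..<n] [0..<n])) = [0..<n * n]) [0..<j]) [0..<k]"

lemma oa_of_check:
  assumes "check_oa k n f"
  shows "oa k {..<n} f"
proof -
  have "inj_on (\<lambda>(a, b). (f i a b, f j a b)) ({..<n} \<times> {..<n})" if "j < k" "i < j" for i j
  proof -
    let ?c = "\<lambda>(a, b). n * f i a b + f j a b"
    have "merge_rounds 7 (map (\<lambda>(a, b). [n * f i a b + f j a b]) (List.product [0..<n] [0..<n])) = [0..<n * n]"
      using assms that unfolding check_oa_def list_all_iff by simp
    moreover have "concat (map (\<lambda>(a, b). [n * f i a b + f j a b]) xs) = map ?c xs" for xs
      by (induction xs) auto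
    ultimately have "distinct (map ?c (List.product [0..<n] [0..<n]))"
      using merge_rounds_eqD(1)[of 7 "map (\<lambda>(a, b). [n * f i a b + f j a b]) (List.product [0..<n] [0..<n])"]
      by simp
    then have "inj_on ?c ({..<n} \<times> {..<n})"
      by (simp add: distinct_map atLeast0LessThan)
    then show ?thesis unfolding inj_on_def by auto
  qed
  then show ?thesis
    using assms unfolding oa_def check_oa_def list_all_iff by simp
qed

section \<open>Small designs\<close>

text \<open>The field with four elements, with all four slopes.\<close>

lemma oa_4: "oa 5 {..<4} (table_oa
    [[0, 1, 2, 3], [1, 0, 3, 2], [2, 3, 0, 1], [3, 2, 1, 0]]
    [[0, 0, 0, 0], [0, 1, 2, 3], [0, 2, 3, 1], [0, 3, 1, 2]])"
  by (rule oa_of_check) code_simp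

text \<open>The field with eight elements, addition being bitwise; the slopes are 0, 1 and a root of
  \<open>x^3 = x + 1\<close>.\<close>

lemma oa_8: "oa 4 {..<8} (table_oa
    [[0, 1, 2, 3, 4, 5, 6, 7], [1, 0, 3, 2, 5, 4, 7, 6], [2, 3, 0, 1, 6, 7, 4, 5],
     [3, 2, 1, 0, 7, 6, 5, 4], [4, 5, 6, 7, 0, 1, 2, 3], [5, 4, 7, 6, 1, 0, 3, 2],
     [6, 7, 4, 5, 2, 3, 0, 1], [7, 6, 5, 4, 3, 2, 1, 0]]
    [[0, 0, 0, 0, 0, 0, 0, 0], [0, 1, 2, 3, 4, 5, 6, 7], [0, 2, 4, 6, 3, 1, 7, 5]])"
  by (rule oa_of_check) code_simp

text \<open>The field with nine elements, \<open>3 * h + l\<close> standing for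
  \<open>h * x + l\<close> with \<open>x^2 = -1\<close>; the slopes are 0, 1, -1 and
  \<open>x\<close>.\<close>

lemma oa_9: "oa 5 {..<9} (table_oa
    [[0, 1, 2, 3, 4, 5, 6, 7, 8], [1, 2, 0, 4, 5, 3, 7, 8, 6], [2, 0, 1, 5, 3, 4, 8, 6, 7],
     [3, 4, 5, 6, 7, 8, 0, 1, 2], [4, 5, 3, 7, 8, 6, 1, 2, 0], [5, 3, 4, 8, 6, 7, 2, 0, 1],
     [6, 7, 8, 0, 1, 2, 3, 4, 5], [7, 8, 6, 1, 2, 0, 4, 5, 3], [8, 6, 7, 2, 0, 1, 5, 3, 4]]
    [[0, 0, 0, 0, 0, 0, 0, 0, 0], [0, 1, 2, 3, 4, 5, 6, 7, 8], [0, 2, 1, 6, 8, 7, 3, 5, 4],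
     [0, 3, 6, 2, 5, 8, 1, 4, 7]])"
  by (rule oa_of_check) code_simp

text \<open>The affine plane of order 4 with one point deleted: the groups are the lines that passed
  through it.\<close>

lemma gdd3_5: "gdd3 5"
proof -
  have "check_blocks 4 3 15
    [[0, 3, 7, 9], [0, 4, 6, 14], [0, 5, 10, 13], [0, 8, 11, 12], [1, 3, 11, 14], [1, 4, 8, 10],
     [1, 5, 7, 12], [1, 6, 9, 13], [2, 3, 8, 13], [2, 4, 9, 12], [2, 5, 6, 11], [2, 7, 10, 14],
     [3, 6, 10, 12], [4, 7, 11, 13], [5, 8, 9, 14]]"
    by code_simp
  then show ?thesis by (rule gdd3_of_check[of 5, simplified])
qed

text \<open>Together with 4 and 5, the orders 8, 9 and 12 form Hanani's classical basis for pairwise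
  balanced designs of all orders 0, 1 mod 4, so these three need explicit designs as well.\<close>

lemma gdd3_8: "gdd3 8"
proof -
  have "check_blocks 4 3 24
    [[0, 3, 8, 23], [0, 4, 11, 22], [0, 5, 9, 15], [0, 6, 13, 20], [0, 7, 14, 21],
     [0, 10, 17, 19], [0, 12, 16, 18], [1, 3, 11, 21], [1, 4, 20, 23], [1, 5, 10, 16],
     [1, 6, 12, 19], [1, 7, 9, 17], [1, 8, 14, 15], [1, 13, 18, 22], [2, 3, 10, 12],
     [2, 4, 9, 13], [2, 5, 8, 20], [2, 6, 15, 21], [2, 7, 11, 19], [2, 14, 16, 22],
     [2, 17, 18, 23], [3, 6, 17, 22], [3, 7, 16, 20], [3, 9, 14, 18], [3, 13, 15, 19],
     [4, 6, 10, 14], [4, 7, 15, 18], [4, 8, 12, 17], [4, 16, 19, 21], [5, 6, 11, 18],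
     [5, 7, 12, 22], [5, 13, 17, 21], [5, 14, 19, 23], [6, 9, 16, 23], [7, 10, 13, 23],
     [8, 9, 19, 22], [8, 10, 18, 21], [8, 11, 13, 16], [9, 12, 20, 21], [10, 15, 20, 22],
     [11, 12, 15, 23], [11, 14, 17, 20]]"
    by code_simp
  then show ?thesis by (rule gdd3_of_check[of 8, simplified])
qed

lemma gdd3_9: "gdd3 9"
proof -
  have "check_blocks 4 3 27
    [[0, 3, 7, 15], [0, 4, 20, 24], [0, 5, 12, 22], [0, 6, 13, 18], [0, 8, 11, 25],
     [0, 9, 19, 21], [0, 10, 14, 16], [0, 17, 23, 26], [1, 3, 13, 23], [1, 4, 8, 16],
     [1, 5, 18, 25], [1, 6, 9, 26], [1, 7, 14, 19], [1, 10, 20, 22], [1, 11, 12, 17],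
     [1, 15, 21, 24], [2, 3, 19, 26], [2, 4, 14, 21], [2, 5, 6, 17], [2, 7, 10, 24],
     [2, 8, 12, 20], [2, 9, 13, 15], [2, 11, 18, 23], [2, 16, 22, 25], [3, 6, 22, 24],
     [3, 8, 10, 18], [3, 9, 12, 25], [3, 11, 16, 21], [3, 14, 17, 20], [4, 6, 11, 19],
     [4, 7, 23, 25], [4, 9, 17, 22], [4, 10, 13, 26], [4, 12, 15, 18], [5, 7, 9, 20],
     [5, 8, 21, 26], [5, 10, 15, 23], [5, 11, 14, 24], [5, 13, 16, 19], [6, 10, 12, 21],
     [6, 14, 15, 25], [6, 16, 20, 23], [7, 11, 13, 22], [7, 12, 16, 26], [7, 17, 18, 21],
     [8, 9, 14, 23], [8, 13, 17, 24], [8, 15, 19, 22], [9, 16, 18, 24], [10, 17, 19, 25],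
     [11, 15, 20, 26], [12, 19, 23, 24], [13, 20, 21, 25], [14, 18, 22, 26]]"
    by code_simp
  then show ?thesis by (rule gdd3_of_check[of 9, simplified])
qed

lemma gdd3_12: "gdd3 12"
proof -
  have "check_blocks 4 3 36
    [[0, 3, 30, 33], [0, 4, 14, 25], [0, 5, 22, 34], [0, 6, 20, 27], [0, 7, 9, 15],
     [0, 8, 13, 18], [0, 10, 12, 26], [0, 11, 19, 31], [0, 16, 32, 35], [0, 17, 23, 28],
     [0, 21, 24, 29], [1, 3, 8, 21], [1, 4, 9, 32], [1, 5, 25, 28], [1, 6, 26, 29],
     [1, 7, 13, 17], [1, 10, 16, 22], [1, 11, 23, 33], [1, 12, 20, 31], [1, 14, 15, 19],
     [1, 18, 30, 34], [1, 24, 27, 35], [2, 3, 13, 35], [2, 4, 19, 24], [2, 5, 9, 20],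
     [2, 6, 22, 25], [2, 7, 29, 30], [2, 8, 15, 32], [2, 10, 18, 21], [2, 11, 16, 34],
     [2, 12, 17, 27], [2, 14, 28, 33], [2, 23, 26, 31], [3, 6, 23, 34], [3, 7, 10, 24],
     [3, 9, 14, 27], [3, 11, 17, 20], [3, 12, 28, 32], [3, 15, 18, 25], [3, 16, 29, 31],
     [3, 19, 22, 26], [4, 6, 12, 15], [4, 7, 23, 27], [4, 8, 10, 17], [4, 11, 29, 35],
     [4, 13, 22, 30], [4, 16, 20, 21], [4, 18, 31, 33], [4, 26, 28, 34], [5, 6, 13, 16],
     [5, 7, 18, 32], [5, 8, 27, 31], [5, 10, 14, 35], [5, 11, 12, 21], [5, 15, 23, 24],
     [5, 17, 26, 30], [5, 19, 29, 33], [6, 9, 21, 30], [6, 10, 32, 33], [6, 11, 18, 28],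
     [6, 14, 24, 31], [6, 17, 19, 35], [7, 11, 14, 22], [7, 12, 16, 33], [7, 19, 21, 28],
     [7, 20, 26, 35], [7, 25, 31, 34], [8, 9, 26, 33], [8, 11, 24, 30], [8, 12, 23, 29],
     [8, 14, 20, 34], [8, 16, 19, 25], [8, 22, 28, 35], [9, 12, 19, 34], [9, 13, 25, 29],
     [9, 16, 24, 28], [9, 17, 22, 31], [9, 18, 23, 35], [10, 13, 28, 31], [10, 15, 29, 34],
     [10, 19, 27, 30], [10, 20, 23, 25], [11, 13, 15, 26], [11, 25, 27, 32], [12, 18, 22, 24],
     [12, 25, 30, 35], [13, 19, 23, 32], [13, 20, 24, 33], [13, 21, 27, 34], [14, 16, 23, 30],
     [14, 17, 18, 29], [14, 21, 26, 32], [15, 20, 28, 30], [15, 21, 31, 35], [15, 22, 27, 33],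
     [16, 18, 26, 27], [17, 21, 25, 33], [17, 24, 32, 34], [20, 22, 29, 32]]"
    by code_simp
  then show ?thesis by (rule gdd3_of_check[of 12, simplified])
qed

text \<open>The blocks are \<open>(a, b, a + b, w * a + b)\<close> over the field with four
  elements, where multiplication by \<open>w\<close> sends 1, 2, 3 to 2, 3, 1. The number
  \<open>4 * i + s\<close> is symbol \<open>s\<close> in group \<open>i\<close>.\<close>

definition td44 :: "nat list list" where
  "td44 =
    [[0, 4, 8, 12], [0, 5, 9, 13], [0, 6, 10, 14], [0, 7, 11, 15], [1, 4, 9, 14], [1, 5, 8, 15],
     [1, 6, 11, 12], [1, 7, 10, 13], [2, 4, 10, 15], [2, 5, 11, 14], [2, 6, 8, 13],
     [2, 7, 9, 12], [3, 4, 11, 13], [3, 5, 10, 12], [3, 6, 9, 15], [3, 7, 8, 14]]"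

lemma common3_td44: "{0, 1, 2, 16} \<subseteq> common3 (blow (complete {..<4::nat}) {..<4::nat})"
proof -
  have "check_common3 4 16 0 td44
    [[0, 4, 11, 14], [0, 5, 9, 15], [0, 6, 10, 13], [0, 7, 8, 12], [1, 4, 8, 15], [1, 5, 10, 14],
     [1, 6, 9, 12], [1, 7, 11, 13], [2, 4, 10, 12], [2, 5, 8, 13], [2, 6, 11, 15], [2, 7, 9, 14],
     [3, 4, 9, 13], [3, 5, 11, 12], [3, 6, 8, 14], [3, 7, 10, 15]]
    [[0, 4, 9, 13], [0, 5, 11, 14], [0, 6, 8, 12], [0, 7, 10, 15], [1, 4, 8, 14], [1, 5, 10, 13],
     [1, 6, 9, 15], [1, 7, 11, 12], [2, 4, 11, 15], [2, 5, 9, 12], [2, 6, 10, 14], [2, 7, 8, 13],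
     [3, 4, 10, 12], [3, 5, 8, 15], [3, 6, 11, 13], [3, 7, 9, 14]]"
    by code_simp
  note k0 = common3_of_check[OF this]
  have "check_common3 4 16 1 td44
    [[0, 4, 11, 12], [0, 5, 9, 13], [0, 6, 10, 15], [0, 7, 8, 14], [1, 4, 10, 13], [1, 5, 8, 12],
     [1, 6, 11, 14], [1, 7, 9, 15], [2, 4, 8, 15], [2, 5, 10, 14], [2, 6, 9, 12], [2, 7, 11, 13],
     [3, 4, 9, 14], [3, 5, 11, 15], [3, 6, 8, 13], [3, 7, 10, 12]]
    [[0, 4, 10, 12], [0, 5, 9, 13], [0, 6, 8, 15], [0, 7, 11, 14], [1, 4, 8, 14], [1, 5, 11, 15],
     [1, 6, 10, 13], [1, 7, 9, 12], [2, 4, 11, 13], [2, 5, 8, 12], [2, 6, 9, 14], [2, 7, 10, 15],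
     [3, 4, 9, 15], [3, 5, 10, 14], [3, 6, 11, 12], [3, 7, 8, 13]]"
    by code_simp
  note k1 = common3_of_check[OF this]
  have "check_common3 4 16 2 td44
    [[0, 4, 10, 15], [0, 5, 9, 13], [0, 6, 8, 12], [0, 7, 11, 14], [1, 4, 11, 12], [1, 5, 8, 14],
     [1, 6, 9, 15], [1, 7, 10, 13], [2, 4, 9, 14], [2, 5, 10, 12], [2, 6, 11, 13], [2, 7, 8, 15],
     [3, 4, 8, 13], [3, 5, 11, 15], [3, 6, 10, 14], [3, 7, 9, 12]]
    [[0, 4, 11, 14], [0, 5, 9, 13], [0, 6, 10, 15], [0, 7, 8, 12], [1, 4, 9, 15], [1, 5, 11, 12],
     [1, 6, 8, 14], [1, 7, 10, 13], [2, 4, 8, 13], [2, 5, 10, 14], [2, 6, 9, 12], [2, 7, 11, 15],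
     [3, 4, 10, 12], [3, 5, 8, 15], [3, 6, 11, 13], [3, 7, 9, 14]]"
    by code_simp
  note k2 = common3_of_check[OF this]
  have "check_common3 4 16 16 td44 td44 td44" by code_simp
  note k16 = common3_of_check[OF this]
  have tr: "k \<in> common3 (blow (complete {..<4::nat}) {..<4::nat})"
    if "k \<in> common3 {(x, y). x < 16 \<and> y < 16 \<and> x div 4 \<noteq> y div (4::nat)}" for k
    using common3_image[OF that inj_div_mod, of 4] div_mod_image[of 4 4] by simp
  show ?thesis using k0 k1 k2 k16 by (auto intro!: tr)
qed

text \<open>The projective plane of order 3 as the translates of the difference set 0, 1, 3, 9
  modulo 13.\<close>

definition pg3 :: "nat list list" where
  "pg3 =
    [[0, 1, 3, 9], [0, 2, 8, 12], [0, 4, 5, 7], [0, 6, 10, 11], [1, 2, 4, 10], [1, 5, 6, 8],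
     [1, 7, 11, 12], [2, 3, 5, 11], [2, 6, 7, 9], [3, 4, 6, 12], [3, 7, 8, 10], [4, 8, 9, 11],
     [5, 9, 10, 12]]"

text \<open>These are all the sizes that \<open>common3_gap\<close> permits for 13 blocks.\<close>

lemma common3_pg3: "{0, 1, 2, 3, 4, 5, 13} \<subseteq> common3 (complete {..<13::nat})"
proof -
  have "check_common3 1 13 0 pg3
    [[0, 1, 3, 12], [0, 2, 6, 9], [0, 4, 10, 11], [0, 5, 7, 8], [1, 2, 5, 10], [1, 4, 7, 9],
     [1, 6, 8, 11], [2, 3, 7, 11], [2, 4, 8, 12], [3, 4, 5, 6], [3, 8, 9, 10], [5, 9, 11, 12],
     [6, 7, 10, 12]]
    [[0, 1, 5, 7], [0, 2, 3, 6], [0, 4, 10, 12], [0, 8, 9, 11], [1, 2, 8, 12], [1, 3, 10, 11],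
     [1, 4, 6, 9], [2, 4, 7, 11], [2, 5, 9, 10], [3, 4, 5, 8], [3, 7, 9, 12], [5, 6, 11, 12],
     [6, 7, 8, 10]]"
    by code_simp
  note k0 = common3_of_check[OF this]
  have "check_common3 1 13 1 pg3
    [[0, 1, 11, 12], [0, 2, 3, 5], [0, 4, 7, 9], [0, 6, 8, 10], [1, 2, 6, 9], [1, 3, 4, 10],
     [1, 5, 7, 8], [2, 4, 8, 12], [2, 7, 10, 11], [3, 6, 7, 12], [3, 8, 9, 11], [4, 5, 6, 11],
     [5, 9, 10, 12]]
    [[0, 1, 7, 10], [0, 2, 3, 9], [0, 4, 8, 12], [0, 5, 6, 11], [1, 2, 6, 12], [1, 3, 5, 8],
     [1, 4, 9, 11], [2, 4, 5, 7], [2, 8, 10, 11], [3, 4, 6, 10], [3, 7, 11, 12], [5, 9, 10, 12],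
     [6, 7, 8, 9]]"
    by code_simp
  note k1 = common3_of_check[OF this]
  have "check_common3 1 13 2 pg3
    [[0, 1, 7, 8], [0, 2, 3, 9], [0, 4, 5, 12], [0, 6, 10, 11], [1, 2, 4, 10], [1, 3, 5, 6],
     [1, 9, 11, 12], [2, 5, 7, 11], [2, 6, 8, 12], [3, 4, 8, 11], [3, 7, 10, 12], [4, 6, 7, 9],
     [5, 8, 9, 10]]
    [[0, 1, 3, 7], [0, 2, 9, 12], [0, 4, 5, 8], [0, 6, 10, 11], [1, 2, 4, 10], [1, 5, 11, 12],
     [1, 6, 8, 9], [2, 3, 5, 6], [2, 7, 8, 11], [3, 4, 9, 11], [3, 8, 10, 12], [4, 6, 7, 12],
     [5, 7, 9, 10]]"
    by code_simp
  note k2 = common3_of_check[OF this]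
  have "check_common3 1 13 3 pg3
    [[0, 1, 3, 6], [0, 2, 8, 11], [0, 4, 5, 7], [0, 9, 10, 12], [1, 2, 4, 10], [1, 5, 9, 11],
     [1, 7, 8, 12], [2, 3, 5, 12], [2, 6, 7, 9], [3, 4, 8, 9], [3, 7, 10, 11], [4, 6, 11, 12],
     [5, 6, 8, 10]]
    [[0, 1, 6, 12], [0, 2, 3, 11], [0, 4, 5, 7], [0, 8, 9, 10], [1, 2, 4, 10], [1, 3, 5, 9],
     [1, 7, 8, 11], [2, 5, 8, 12], [2, 6, 7, 9], [3, 4, 6, 8], [3, 7, 10, 12], [4, 9, 11, 12],
     [5, 6, 10, 11]]"
    by code_simp
  note k3 = common3_of_check[OF this]
  have "check_common3 1 13 4 pg3
    [[0, 1, 3, 12], [0, 2, 8, 9], [0, 4, 5, 7], [0, 6, 10, 11], [1, 2, 4, 10], [1, 5, 6, 9],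
     [1, 7, 8, 11], [2, 3, 5, 11], [2, 6, 7, 12], [3, 4, 6, 8], [3, 7, 9, 10], [4, 9, 11, 12],
     [5, 8, 10, 12]]
    [[0, 1, 3, 8], [0, 2, 9, 12], [0, 4, 5, 7], [0, 6, 10, 11], [1, 2, 4, 10], [1, 5, 6, 12],
     [1, 7, 9, 11], [2, 3, 5, 11], [2, 6, 7, 8], [3, 4, 6, 9], [3, 7, 10, 12], [4, 8, 11, 12],
     [5, 8, 9, 10]]"
    by code_simp
  note k4 = common3_of_check[OF this]
  have "check_common3 1 13 5 pg3
    [[0, 1, 3, 9], [0, 2, 4, 12], [0, 5, 6, 11], [0, 7, 8, 10], [1, 2, 5, 8], [1, 4, 6, 10],
     [1, 7, 11, 12], [2, 3, 10, 11], [2, 6, 7, 9], [3, 4, 5, 7], [3, 6, 8, 12], [4, 8, 9, 11],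
     [5, 9, 10, 12]]
    [[0, 1, 3, 9], [0, 2, 5, 11], [0, 4, 7, 10], [0, 6, 8, 12], [1, 2, 8, 10], [1, 4, 5, 6],
     [1, 7, 11, 12], [2, 3, 4, 12], [2, 6, 7, 9], [3, 5, 7, 8], [3, 6, 10, 11], [4, 8, 9, 11],
     [5, 9, 10, 12]]"
    by code_simp
  note k5 = common3_of_check[OF this]
  have "check_common3 1 13 13 pg3 pg3 pg3" by code_simp
  note k13 = common3_of_check[OF this]
  \<comment> \<open>Groups of length 1 turn the multipartite graph into the complete one.\<close>
  have "{(x, y). x < 13 \<and> y < 13 \<and> x div 1 \<noteq> y div (1::nat)} = complete {..<13}"
    by (auto simp: complete_def)
  then show ?thesis using k0 k1 k2 k3 k4 k5 k13 by simp
qed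

section \<open>Existence of group divisible designs\<close>

lemma oa_cyclic_3: "oa 4 {..<3} (cyclic_oa 3)"
proof (rule oa_cyclic)
  fix d :: nat assume "0 < d" "d + 1 < 4"
  then have "d = 1 \<or> d = 2" by linarith
  then show "coprime d 3" by auto
qed simp

text \<open>The slopes 0 to 3 differ by 1, 2 or 3, all units modulo a number prime to 6.\<close>

lemma oa_cyclic_5:
  assumes "coprime 6 t"
  shows "oa 5 {..<t} (cyclic_oa t)"
proof (rule oa_cyclic)
  have t: "coprime 2 t" "coprime 3 t"
    using assms coprime_mult_left_iff[of 2 3 t] by simp_all
  fix d :: nat assume "0 < d" "d + 1 < 5"
  then have "d = 1 \<or> d = 2 \<or> d = 3" by linarith
  then show "coprime d t" using t by auto
next
  show "0 < t" using assms by (cases t) simp_all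
qed

text \<open>Orders prime to 6 come from cyclic arrays, 4, 8 and 9 from fields, and
  \<open>20 = 5 * 4\<close>, \<open>12 = 3 * 4\<close> from products.\<close>

lemma td_instances: "td 5 5" "td 5 13" "td 5 17" "td 5 25" "td 5 29" "td 5 37" "td 5 41"
  "td 5 (12 * q + 1)" "td 4 7" "td 5 4" "td 4 4" "td 4 8" "td 5 9" "td 4 9" "td 5 20" "td 4 12"
proof -
  have c: "coprime 6 n" if "n mod 6 \<in> {1, 5}" for n :: nat
    using that coprime_mod_right_iff[of 6 n] by (auto simp: coprime_iff_gcd_eq_1 gcd_non_0_nat)
  have td: "td 5 t" if "t mod 6 \<in> {1, 5}" for t
    using oa_td[OF oa_cyclic_5[OF c[OF that]]] by simp
  show "td 5 5" "td 5 13" "td 5 17" "td 5 25" "td 5 29" "td 5 37" "td 5 41"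
    by (intro td; simp)+
  show "td 5 (12 * q + 1)"
  proof (rule td)
    have "(12 * q + 1) mod 6 = 1" by presburger
    then show "(12 * q + 1) mod 6 \<in> {1, 5}" by simp
  qed
  show "td 4 7"
    using oa_td[OF oa_mono[OF oa_cyclic_5[OF c], of 7 4]] by simp
  show "td 5 4" "td 4 4" "td 4 8" "td 5 9" "td 4 9"
    using oa_td[OF oa_4] oa_td[OF oa_mono[OF oa_4, of 4]] oa_td[OF oa_8] oa_td[OF oa_9]
      oa_td[OF oa_mono[OF oa_9, of 4]] by simp_all
  show "td 5 20"
    using oa_td[OF oa_prod[OF oa_cyclic_5[OF c] oa_4], of 5] by simp
  from oa_td[OF oa_prod[OF oa_cyclic_3 oa_mono[OF oa_4, of 4]]] show "td 4 12" by simp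
qed

text \<open>A TD(4,3) is literally a 4-GDD with four groups of size 3.\<close>

lemma gdd3_4: "gdd3 4"
  using oa_td[OF oa_cyclic_3] by (simp add: td_def gdd3_def)

lemma gdd3_exists: "u mod 4 = 0 \<or> u mod 4 = 1 \<Longrightarrow> gdd3 u"
proof (induction u rule: less_induct)
  case (less u)
  have step: "gdd3 u" if t: "td 5 t" "t mod 4 = 0 \<or> t mod 4 = 1" "0 < t" "4 * t \<le> u" "u \<le> 5 * t" for t
  proof -
    define h where "h = u - 4 * t"
    have u: "u = 4 * t + h" using t(4) by (simp add: h_def)
    \<comment> \<open>\<open>h\<close> stays in the admissible residue classes, so the induction
      hypothesis covers it.\<close>
    have "h mod 4 = u mod 4" unfolding u by simp
    then have h: "gdd3 h" using less.prems t(3) by (intro less.IH) (simp_all add: u)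
    have t': "gdd3 t" using t(2-4) by (intro less.IH) simp_all
    have "h \<le> t" using t(5) unfolding u by simp
    have "td (Suc 4) t" "gdd3 (Suc 4)" using t(1) gdd3_5 by simp_all
    then show ?thesis unfolding u using \<open>h \<le> t\<close> gdd3_4 t' h by (intro gdd3_td_truncate)
  qed
  have IH: "gdd3 w" if "w < u" "w mod 4 = 0 \<or> w mod 4 = 1" for w
    by (rule less.IH[OF that])
  \<comment> \<open>From 52 on, the ranges from \<open>4 * t\<close> to \<open>5 * t\<close> for t =
    13, 17, 20, 25, 29, 37, 41 reach up to 205, leaving out only 66, 67, 146 and 147, which are 2 or
    3 mod 4. The smaller orders are grouped by the construction that yields them.\<close>
  consider "u \<le> 1" | "u \<in> {4, 5, 8, 9, 12}" | "u \<in> {13, 16, 28, 37, 40, 49}" | "u \<in> {17, 29, 33}"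
    | "u \<in> {32, 36, 48}" | "u \<in> {20, 21, 24, 25, 41, 44, 45}"
    | "52 \<le> u \<and> u \<le> 65" | "68 \<le> u \<and> u \<le> 85" | "80 \<le> u \<and> u \<le> 100" | "100 \<le> u \<and> u \<le> 125"
    | "116 \<le> u \<and> u \<le> 145" | "148 \<le> u \<and> u \<le> 185" | "164 \<le> u \<and> u \<le> 205" | "196 \<le> u"
  proof -
    have "u \<le> 1 \<or> u \<in> {4, 5, 8, 9, 12} \<or> u \<in> {13, 16, 28, 37, 40, 49} \<or> u \<in> {17, 29, 33}
      \<or> u \<in> {32, 36, 48} \<or> u \<in> {20, 21, 24, 25, 41, 44, 45}" if "u < 52"
    proof -
      define q where "q = u div 4"
      have "q < 13" using that by (simp add: q_def)
      then have "q = 0 \<or> q = 1 \<or> q = 2 \<or> q = 3 \<or> q = 4 \<or> q = 5 \<or> q = 6 \<or> q = 7 \<or> q = 8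
        \<or> q = 9 \<or> q = 10 \<or> q = 11 \<or> q = 12" by presburger
      moreover have "u = 4 * q \<or> u = 4 * q + 1" using less.prems unfolding q_def by presburger
      ultimately show ?thesis by (elim disjE) simp_all
    qed
    moreover have "u \<noteq> 66 \<and> u \<noteq> 67 \<and> u \<noteq> 146 \<and> u \<noteq> 147" using less.prems by auto
    moreover have "52 \<le> u \<and> u \<le> 65 \<or> 68 \<le> u \<and> u \<le> 85 \<or> 80 \<le> u \<and> u \<le> 100 \<or> 100 \<le> u \<and> u \<le> 125
      \<or> 116 \<le> u \<and> u \<le> 145 \<or> 148 \<le> u \<and> u \<le> 185 \<or> 164 \<le> u \<and> u \<le> 205 \<or> 196 \<le> u"
      if "52 \<le> u" using that calculation(2) by linarith
    ultimately show thesis using that not_less[of u 52] by metis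
  qed
  then show ?case
  proof cases
    case 1 then show ?thesis by (rule gdd3_trivial)
  next
    case 2 then show ?thesis using gdd3_4 gdd3_5 gdd3_8 gdd3_9 gdd3_12 by auto
  next
    case 3
    then have "gdd3 (u div 3)" "u = 3 * (u div 3) + 1" by (auto intro!: IH)
    then show ?thesis using gdd3_triple gdd3_4 by metis
  next
    case 4
    then consider "u = 4 * 4 + 1" | "u = 4 * 7 + 1" | "u = 4 * 8 + 1" by auto
    then show ?thesis
      by cases (use gdd3_td_point[of 4 4] gdd3_td_point[of 4 7] gdd3_td_point[of 4 8]
        td_instances gdd3_4 gdd3_5 gdd3_8 gdd3_9 in auto)
  next
    case 5
    then consider "u = 4 * 8" | "u = 4 * 9" | "u = 4 * 12" by auto
    then show ?thesis
      by cases (use gdd3_td[of 4 8] gdd3_td[of 4 9] gdd3_td[of 4 12]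
        td_instances gdd3_4 gdd3_8 gdd3_9 gdd3_12 in auto)
  next
    case 6
    then consider "u = 20" | "20 \<le> u \<and> u \<le> 25" | "36 \<le> u \<and> u \<le> 45" by auto
    then show ?thesis
      by cases (use step[of 4] step[of 5] step[of 9] td_instances in auto)
  next
    case 7 then show ?thesis using step[of 13] td_instances by simp
  next
    case 8 then show ?thesis using step[of 17] td_instances by simp
  next
    case 9 then show ?thesis using step[of 20] td_instances by simp
  next
    case 10 then show ?thesis using step[of 25] td_instances by simp
  next
    case 11 then show ?thesis using step[of 29] td_instances by simp
  next
    case 12 then show ?thesis using step[of 37] td_instances by simp
  next
    case 13 then show ?thesis using step[of 41] td_instances by simp
  next
    case 14
    \<comment> \<open>With \<open>t = 12 * q + 1\<close> this is the largest \<open>q\<close> with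
      \<open>4 * t \<le> u\<close>. Then \<open>u < 48 * q + 52\<close>, and
      \<open>u \<le> 5 * t = 60 * q + 5\<close> follows from \<open>q \<ge> 4\<close>, that is, from
      \<open>u \<ge> 196\<close>.\<close>
    define q where "q = (u - 4) div 48"
    have "48 * q \<le> u - 4" "u - 4 < 48 * q + 48" unfolding q_def by simp_all
    moreover have "4 \<le> q" unfolding q_def using 14 by simp
    moreover have "(12 * q + 1) mod 4 = 1" by presburger
    ultimately show ?thesis using step[OF td_instances(8)[of q]] 14 by simp
  qed
qed

section \<open>Combining the ingredients\<close>

primrec sumset :: "nat set \<Rightarrow> nat \<Rightarrow> nat set" where
  "sumset A 0 = {0}"
| "sumset A (Suc n) = {a + s | a s. a \<in> A \<and> s \<in> sumset A n}"

lemma sumset_SucI: "a \<in> A \<Longrightarrow> s \<in> sumset A n \<Longrightarrow> a + s \<in> sumset A (Suc n)"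
  by auto

text \<open>Distributes a prescribed total over the blocks or groups as individual sizes.\<close>

lemma sumset_fun:
  assumes "finite X" "k \<in> sumset A (card X)"
  shows "\<exists>t. (\<forall>x\<in>X. t x \<in> A) \<and> (\<Sum>x\<in>X. t x) = k"
  using assms
proof (induction X arbitrary: k rule: finite_induct)
  case (insert x X)
  then obtain a s where as: "k = a + s" "a \<in> A" "s \<in> sumset A (card X)" by auto
  then obtain t where t: "\<forall>x\<in>X. t x \<in> A" "(\<Sum>x\<in>X. t x) = s" using insert.IH by blast
  have "(\<Sum>y\<in>X. (t(x := a)) y) = s"
    using t(2) insert.hyps(2) by (auto intro!: sum.cong)
  then have "(\<Sum>y\<in>insert x X. (t(x := a)) y) = k" using insert.hyps as(1) by simp
  moreover have "\<forall>y\<in>insert x X. (t(x := a)) y \<in> A" using t(1) as(2) by simp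
  ultimately show ?case by blast
qed simp

lemma sumset_add: "k \<in> sumset A m \<Longrightarrow> l \<in> sumset A n \<Longrightarrow> k + l \<in> sumset A (m + n)"
proof (induction m arbitrary: k)
  case (Suc m)
  then obtain a s where "k = a + s" "a \<in> A" "s \<in> sumset A m" by auto
  then show ?case using Suc.IH[of s] Suc.prems(2) by (auto simp: add.assoc)
qed simp

lemma sumset_const: "a \<in> A \<Longrightarrow> n * a \<in> sumset A n"
  by (induction n) auto

text \<open>Greedy choice: each summand takes as much of \<open>k\<close> as \<open>d\<close>
  allows.\<close>

lemma sumset_interval:
  assumes "{0..d} \<subseteq> A" "k \<le> n * d"
  shows "k \<in> sumset A n"
  using assms(2)
proof (induction n arbitrary: k)
  case (Suc n)
  have "k - min k d \<in> sumset A n" using Suc.prems by (intro Suc.IH) (cases "k \<le> d"; simp add: min_def le_diff_conv add.commute)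
  moreover have "min k d \<in> A" using assms(1) by auto
  moreover have "k = min k d + (k - min k d)" by simp
  ultimately show ?case unfolding sumset.simps by blast
qed simp

abbreviation "pg3_sizes \<equiv> {0, 1, 2, 3, 4, 5, 13 :: nat}"
abbreviation "td44_sizes \<equiv> {0, 1, 2, 16 :: nat}"

text \<open>A single plane falls short of 13 by 0 or by 8 to 13, and two short planes by at least
  16, so shortfalls of 14 and 15 are excluded besides the gap itself. From four planes on, a further
  one contributes 13 or 0.\<close>

lemma sumset_pg3:
  assumes "4 \<le> u" "j = 13 * u \<or> j + 8 \<le> 13 * u" "j + 14 \<noteq> 13 * u" "j + 15 \<noteq> 13 * u"
  shows "j \<in> sumset pg3_sizes u"
  using assms
proof (induction u arbitrary: j rule: dec_induct)
  case base
  have *: "13 * q + i \<in> sumset pg3_sizes 4" if "q \<le> 4" "i \<le> 5 * (4 - q)" for q i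
  proof -
    have "{0..5} \<subseteq> pg3_sizes" by auto
    then have "i \<in> sumset pg3_sizes (4 - q)" using sumset_interval that(2) by (metis mult.commute)
    moreover have "q * 13 \<in> sumset pg3_sizes q" by (rule sumset_const) simp
    ultimately show ?thesis using sumset_add that(1) by (metis le_add_diff_inverse mult.commute)
  qed
  \<comment> \<open>With \<open>q\<close> full planes the totals run from \<open>13 * q\<close> to
    \<open>13 * q + 5 * (4 - q)\<close>. These ranges miss only 37 and 38, which fall short of 52 by
    15 and 14, and the gap from 45 to 51.\<close>
  consider "j \<le> 20" | "13 \<le> j \<and> j \<le> 28" | "26 \<le> j \<and> j \<le> 36" | "39 \<le> j \<and> j \<le> 44" | "j = 52"
    using base by linarith
  then obtain q i where "q \<le> 4" "i \<le> 5 * (4 - q)" "j = 13 * q + i"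
  proof cases
    case 1 then show thesis using that[of 0 j] by simp
  next
    case 2 then show thesis using that[of 1 "j - 13"] by simp
  next
    case 3 then show thesis using that[of 2 "j - 26"] by simp
  next
    case 4 then show thesis using that[of 3 "j - 39"] by simp
  next
    case 5 then show thesis using that[of 4 0] by simp
  qed
  then show ?case using * by simp
next
  case (step u)
  show ?case
  proof (cases "13 \<le> j")
    case True
    then have "j - 13 \<in> sumset pg3_sizes u" using step.prems step.hyps by (intro step.IH) auto
    then have "13 + (j - 13) \<in> sumset pg3_sizes (Suc u)" by (intro sumset_SucI) simp_all
    then show ?thesis using True by simp
  next
    case False
    then have "j \<in> sumset pg3_sizes u" using step.hyps by (intro step.IH) auto
    then have "0 + j \<in> sumset pg3_sizes (Suc u)" by (intro sumset_SucI) simp_all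
    then show ?thesis by simp
  qed
qed

text \<open>Below \<open>16 * N\<close>, full transversal designs give the multiple of 16 and the
  planes the remainder, at most 15. Above, all transversal designs are full and the planes vary. The
  shortfalls 14 and 15, out of reach for planes, arise by lowering one transversal design from 16 to
  2 or 1.\<close>

lemma sumset_td44_pg3:
  assumes u: "4 \<le> u" and N: "1 \<le> N" and k: "k = 16 * N + 13 * u \<or> k + 8 \<le> 16 * N + 13 * u"
  shows "\<exists>t s. t \<in> sumset td44_sizes N \<and> s \<in> sumset pg3_sizes u \<and> k = t + s"
proof -
  have m: "16 * m \<in> sumset td44_sizes N" if "m \<le> N" for m
    using sumset_add[OF sumset_const[of 16 td44_sizes m] sumset_const[of 0 td44_sizes "N - m"]] that
    by (simp add: mult.commute)
  have m': "16 * (N - 1) + d \<in> sumset td44_sizes N" if "d \<in> td44_sizes" for d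
    using sumset_add[OF sumset_const[of 16 td44_sizes "N - 1"] sumset_const[OF that, of 1]] N
    by (simp add: mult.commute)
  consider "k < 16 * N" | d where "d \<in> {1, 2}" "k = 16 * (N - 1) + d + 13 * u"
    | "16 * N \<le> k" "k - 16 * N + 14 \<noteq> 13 * u" "k - 16 * N + 15 \<noteq> 13 * u"
  proof (cases "k < 16 * N")
    case False
    show thesis
    proof (cases "k + 14 = 16 * N + 13 * u \<or> k + 15 = 16 * N + 13 * u")
      case True
      then show thesis using that(2)[of 1] that(2)[of 2] N by auto
    next
      case no: False
      then show thesis using that(3) False by auto
    qed
  qed
  then show ?thesis
  proof cases
    case 1
    have "k div 16 \<le> N" using 1 by simp
    moreover have "k mod 16 < 16" by simp
    then have "k mod 16 \<in> sumset pg3_sizes u" using u by (intro sumset_pg3) linarith+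
    moreover have "k = 16 * (k div 16) + k mod 16" by simp
    ultimately show ?thesis using m by blast
  next
    case 2
    have "13 * u \<in> sumset pg3_sizes u" using u by (intro sumset_pg3) simp_all
    then show ?thesis using m'[of d] 2 by blast
  next
    case 3
    have "k - 16 * N \<in> sumset pg3_sizes u" using u k 3 by (intro sumset_pg3) auto
    moreover have "k = 16 * N + (k - 16 * N)" using 3 by simp
    ultimately show ?thesis using m[of N] by blast
  qed
qed

section \<open>Relabelling and gluing the ingredients\<close>

lemma common3_complete_bij:
  assumes "k \<in> common3 (complete X)" "finite X" "finite Y" "card X = card Y"
  shows "k \<in> common3 (complete Y)"
proof -
  obtain f where f: "bij_betw f X Y" using finite_same_card_bij assms(2-4) by blast
  then have inj: "inj_on f X" by (simp add: bij_betw_def)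
  show ?thesis
    using common3_image[OF assms(1) inj_on_subset[OF inj Field_complete]] image_complete[OF inj] f
    by (simp add: bij_betw_def)
qed

lemma common3_blow_bij:
  assumes "k \<in> common3 (blow (complete X) W)" "finite X" "finite Y" "card X = card Y"
  shows "k \<in> common3 (blow (complete Y) W)"
proof -
  obtain f where f: "bij_betw f X Y" using finite_same_card_bij assms(2-4) by blast
  then have inj: "inj_on f X" by (simp add: bij_betw_def)
  show ?thesis
    using common3_image[OF assms(1) inj_on_blow_complete[OF inj, of id]] f
    unfolding image_blow image_complete[OF inj] by (simp add: bij_betw_def)
qed

lemma common3_Un:
  assumes "k \<in> common3 E" "l \<in> common3 F" "finite E" "finite F" "E \<inter> F = {}"
  shows "k + l \<in> common3 (E \<union> F)"
proof -
  have "(\<Sum>i\<in>UNIV. if i then k else l) \<in> common3 (\<Union>i\<in>UNIV. if i then E else F)"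
    by (rule common3_UN) (use assms in \<open>auto simp: disjoint_family_on_def split: if_splits\<close>)
  then show ?thesis by (simp add: UNIV_bool Un_commute add.commute)
qed

lemma card_blow:
  assumes "finite E" "finite W"
  shows "card (blow E W) = card E * card W * card W"
proof -
  have "blow E W = (\<lambda>((x, y), (i, j)). ((x, i), (y, j))) ` (E \<times> W \<times> W)"
    by (auto simp: blow_def image_iff) force
  moreover have "inj_on (\<lambda>((x, y), (i, j)). ((x, i), (y, j))) (E \<times> W \<times> W)"
    by (auto simp: inj_on_def)
  ultimately show ?thesis using card_image by (fastforce simp: card_cartesian_product)
qed

text \<open>A point \<open>Some ((x, i), j)\<close> is copy \<open>j\<close> of point
  \<open>i\<close> in group \<open>x\<close> of the 4-GDD. Pairs from different groups lie over an
  edge of the 4-GDD and are covered by transversal designs; pairs within a group or with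
  \<open>None\<close> lie in one of the 13-point sets \<open>group x\<close>.\<close>

lemma J3_superset:
  assumes gdd: "gdd3 u" and u: "4 \<le> u" and v: "v = 12 * u + 1"
  shows "I3 v \<subseteq> J3 v"
proof
  fix i assume i: "i \<in> I3 v"
  obtain B where B: "decomp {4} (blow (complete {..<u}) {..<3::nat}) B"
    using gdd unfolding gdd3_def by blast
  let ?E = "blow (complete {..<u}) {..<3::nat}" and ?W = "{..<4::nat}"
  define group where "group x = insert None (Some ` (({x} \<times> {..<3::nat}) \<times> ?W))" for x :: nat
  define V where "V = insert None (Some ` (({..<u} \<times> {..<3::nat}) \<times> ?W))"
  have finE: "finite ?E" by (intro finite_blow finite_complete) simp_all
  have finB: "finite B" using decomp_finite[OF B finE] .
  have fb: "finite b" if "b \<in> B" for b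
    using decomp_card_ge[OF B that] card.infinite by fastforce
  have "12 * card B = u * (u - 1) * 3 * 3"
    using card_decomp4[OF B finE] by (simp add: card_blow finite_complete card_complete)
  then have cB: "4 * card B = 3 * (u * (u - 1))" by simp
  \<comment> \<open>Multiplying by 4 avoids the fraction in
    \<open>card B = 3 * u * (u - 1) / 4\<close>.\<close>
  have "4 * (16 * card B + 13 * u) = 4 * (u * v)"
  proof -
    obtain w where "u = Suc w" using u by (cases u) auto
    then show ?thesis using cB v by (simp add: algebra_simps)
  qed
  then have tot: "16 * card B + 13 * u = u * v" by simp
  have nb: "num_blocks v = int (u * v)"
    unfolding num_blocks_def by (simp add: v algebra_simps)
  define k where "k = nat i"
  have ik: "i = int k" using i by (simp add: I3_def k_def)
  have k: "k = 16 * card B + 13 * u \<or> k + 8 \<le> 16 * card B + 13 * u"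
    using i unfolding I3_def nb ik tot by (auto simp del: of_nat_mult)
  \<comment> \<open>At least one transversal design must be available for lowering to 1 or 2 common
    blocks.\<close>
  have B1: "1 \<le> card B"
  proof (rule ccontr)
    assume "\<not> ?thesis"
    then have "card B = 0" by simp
    then have "u * (u - 1) = 0" using cB by simp
    then show False using u by auto
  qed
  obtain t s where t: "t \<in> sumset td44_sizes (card B)" and s: "s \<in> sumset pg3_sizes u" and kts: "k = t + s"
    using sumset_td44_pg3[OF u B1 k] by blast
  obtain f where f: "\<And>b. b \<in> B \<Longrightarrow> f b \<in> td44_sizes" "(\<Sum>b\<in>B. f b) = t"
    using sumset_fun[OF finB t] by blast
  have "\<exists>g. (\<forall>x\<in>{..<u}. g x \<in> pg3_sizes) \<and> (\<Sum>x<u. g x) = s"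
    by (rule sumset_fun) (use s in simp_all)
  then obtain g where g: "\<And>x. x \<in> {..<u} \<Longrightarrow> g x \<in> pg3_sizes" "(\<Sum>x<u. g x) = s" by blast
  have "t \<in> common3 (blow ?E ?W)"
  proof -
    have "f b \<in> common3 (blow (complete b) ?W)" if "b \<in> B" for b
    proof -
      have "f b \<in> common3 (blow (complete {..<4::nat}) ?W)" using common3_td44 f(1)[OF that] by blast
      then show ?thesis
        by (rule common3_blow_bij) (use fb[OF that] decomp_card[OF B that] in auto)
    qed
    \<comment> \<open>Inflating one block of the 4-GDD gives the graph of a TD(4,4), and
      edge-disjoint blocks stay edge-disjoint.\<close>
    then have "(\<Sum>b\<in>B. f b) \<in> common3 (\<Union>b\<in>B. blow (complete b) ?W)"
      by (intro common3_UN finB finite_blow finite_complete fb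
          disjoint_family_blow decomp_disjoint_complete[OF B]) simp_all
    then show ?thesis
      unfolding f(2) blow_UN[symmetric] decomp_eq_UN_complete[OF B, symmetric] .
  qed
  then have 1: "t \<in> common3 (map_prod Some Some ` blow ?E ?W)" by (rule common3_image) simp
  have 2: "s \<in> common3 (\<Union>x\<in>{..<u}. complete (group x))"
    unfolding g(2)[symmetric]
  proof (rule common3_UN)
    \<comment> \<open>Two of the 13-point sets share only \<open>None\<close>, hence no
      edge.\<close>
    show "disjoint_family_on (\<lambda>x. complete (group x)) {..<u}"
      by (auto simp: disjoint_family_on_def complete_def group_def)
    fix x assume x: "x \<in> {..<u}"
    have fin: "finite (group x)" by (simp add: group_def)
    then show "finite (complete (group x))" by (rule finite_complete)
    have "card (Some ` (({x} \<times> {..<3::nat}) \<times> ?W)) = 12" by (simp add: card_image card_cartesian_product)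
    then have "card (group x) = 13" unfolding group_def by (subst card_insert_disjoint) auto
    moreover have "g x \<in> common3 (complete {..<13::nat})" using common3_pg3 g(1) x by blast
    ultimately show "g x \<in> common3 (complete (group x))"
      using common3_complete_bij[of "g x" "{..<13::nat}" "group x"] fin by simp
  qed simp
  have "map_prod Some Some ` blow ?E ?W \<inter> (\<Union>x\<in>{..<u}. complete (group x)) = {}"
    by (auto simp: blow_def complete_def group_def)
  then have "k \<in> common3 (map_prod Some Some ` blow ?E ?W \<union> (\<Union>x\<in>{..<u}. complete (group x)))"
    unfolding kts using 1 2 finE
    by (intro common3_Un finite_imageI finite_blow) (auto intro!: finite_complete simp: group_def)
  also have "map_prod Some Some ` blow ?E ?W \<union> (\<Union>x\<in>{..<u}. complete (group x)) = complete V"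
  proof (intro set_eqI iffI)
    fix e assume "e \<in> complete V"
    then obtain p q where e: "e = (p, q)" "p \<in> V" "q \<in> V" "p \<noteq> q" by (auto simp: complete_def)
    consider x where "x < u" "p \<in> group x" "q \<in> group x"
      | x i j y i' j' where "p = Some ((x, i), j)" "q = Some ((y, i'), j')" "x \<noteq> y"
        "x < u" "y < u" "i < 3" "i' < 3" "j < 4" "j' < 4"
    proof (cases p)
      case None
      then obtain x i j where "q = Some ((x, i), j)" "x < u" "i < 3" "j < 4" using e by (auto simp: V_def)
      then show thesis using that(1)[of x] None by (simp add: group_def)
    next
      case (Some p')
      then obtain x i j where p: "p = Some ((x, i), j)" "x < u" "i < 3" "j < 4" using e by (auto simp: V_def)
      show thesis
      proof (cases q)
        case None
        then show thesis using that(1)[of x] p by (simp add: group_def)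
      next
        case (Some q')
        then obtain y i' j' where q: "q = Some ((y, i'), j')" "y < u" "i' < 3" "j' < 4"
          using e by (auto simp: V_def)
        show thesis
        proof (cases "x = y")
          case True
          then show thesis using that(1)[of x] p q by (simp add: group_def)
        next
          case False
          then show thesis using that(2)[of x i j y i' j'] p q by simp
        qed
      qed
    qed
    then show "e \<in> map_prod Some Some ` blow ?E ?W \<union> (\<Union>x\<in>{..<u}. complete (group x))"
    proof cases
      case 1
      then have "e \<in> complete (group x)" using e by (simp add: complete_def)
      then show ?thesis using 1(1) by blast
    next
      case 2
      then have "(((x, i), j), ((y, i'), j')) \<in> blow ?E ?W" by (simp add: blow_def complete_def)
      then have "e \<in> map_prod Some Some ` blow ?E ?W" using 2 e by (intro image_eqI) auto
      then show ?thesis by blast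
    qed
  qed (auto simp: complete_def blow_def V_def group_def)
  finally have "k \<in> common3 (complete V)" .
  moreover have "finite V" by (simp add: V_def)
  moreover have "card V = v"
  proof -
    have "card (Some ` (({..<u} \<times> {..<3::nat}) \<times> ?W)) = 12 * u"
      by (simp add: card_image card_cartesian_product)
    then show ?thesis unfolding V_def v by (subst card_insert_disjoint) auto
  qed
  ultimately show "i \<in> J3 v" unfolding ik by (rule common3_complete_in_J3)
qed

theorem theorem5p1:
  fixes u v :: nat
  assumes "v = 12 * u + 1"
    and "[u = 0] (mod 4) \<or> [u = 1] (mod 4)"
    and "u \<ge> 4"
  shows "J3 v = I3 v"
proof -
  have "gdd3 u" using assms(2) by (intro gdd3_exists) (simp add: cong_def)
  then show ?thesis using J3_superset J3_subset_I3 assms by blast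
qed

end
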